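(* Iterative-Local-Backbone restricted to Krom formulas is solvable in polynomial time.
   Context: A clause is a finite set of literals not containing both $x$ and $\neg x$; the complement $\overline{l}$ of $x$ is $\neg x$ and vice versa. A CNF formula is a finite set of clauses, $|\varphi|$ its number of clauses, $\mathrm{Var}(\varphi)$ its variables. A Krom formula is a CNF formula all of whose clauses have at most 2 literals. For a literal $l$, the reduct $\varphi|_l$ is obtained by deleting all clauses containing $l$ and removing $\overline{l}$ from the remaining clauses. $\varphi\models\psi$ means every assignment satisfying $\varphi$ satisfies $\psi$. A variable $x$ is a $k$-backbone of $\varphi$ if there is $\varphi'\subseteq\varphi$ with $|\varphi'|\le k$ and $\varphi'\models x$ or $\varphi'\models\neg x$. A variable $x$ is an iterative $k$-backbone of $\varphi$ if either (i) $x$ is a $k$-backbone of $\varphi$, or (ii) there is $y\in\mathrm{Var}(\varphi)$ that is a $k$-backbone of $\varphi$ and $l\in\{y,\neg y\}$ with $\varphi\models l$ such that $x$ is an iterative $k$-backbone of $\varphi|_l$. Iterative-Local-Backbone$[\mathcal{C}]$: given $\varphi\in\mathcal{C}$, a variable $x$ of $\varphi$, and $k\ge1$, decide whether $x$ is an iterative $k$-backbone of $\varphi$. *)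

theory Defs
  imports "HOL-Computational_Algebra.Polynomial"
begin

section \<open>Propositional formulas\<close>

datatype 'v lit = Pos 'v | Neg 'v

fun compl :: "'v lit \<Rightarrow> 'v lit" where
  "compl (Pos x) = Neg x"
| "compl (Neg x) = Pos x"

fun var_of :: "'v lit \<Rightarrow> 'v" where
  "var_of (Pos x) = x"
| "var_of (Neg x) = x"

type_synonym 'v clause = "'v lit set"
type_synonym 'v formula = "'v clause set"

definition is_clause :: "'v clause \<Rightarrow> bool" where
  "is_clause C \<longleftrightarrow> finite C \<and> (\<forall>x. \<not> (Pos x \<in> C \<and> Neg x \<in> C))"

definition cnf :: "'v formula \<Rightarrow> bool" where
  "cnf \<phi> \<longleftrightarrow> finite \<phi> \<and> (\<forall>C\<in>\<phi>. is_clause C)"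

definition krom :: "'v formula set" where
  "krom = {\<phi>. cnf \<phi> \<and> (\<forall>C\<in>\<phi>. card C \<le> 2)}"

definition vars :: "'v formula \<Rightarrow> 'v set" where
  "vars \<phi> = var_of ` \<Union>\<phi>"

definition reduct :: "'v formula \<Rightarrow> 'v lit \<Rightarrow> 'v formula" where
  "reduct \<phi> l = {C - {compl l} | C. C \<in> \<phi> \<and> l \<notin> C}"

fun sat_lit :: "('v \<Rightarrow> bool) \<Rightarrow> 'v lit \<Rightarrow> bool" where
  "sat_lit \<alpha> (Pos x) = \<alpha> x"
| "sat_lit \<alpha> (Neg x) = (\<not> \<alpha> x)"

definition satisfies :: "('v \<Rightarrow> bool) \<Rightarrow> 'v formula \<Rightarrow> bool" where
  "satisfies \<alpha> \<phi> \<longleftrightarrow> (\<forall>C\<in>\<phi>. \<exists>l\<in>C. sat_lit \<alpha> l)"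

definition entails :: "'v formula \<Rightarrow> 'v formula \<Rightarrow> bool" where
  "entails \<phi> \<psi> \<longleftrightarrow> (\<forall>\<alpha>. satisfies \<alpha> \<phi> \<longrightarrow> satisfies \<alpha> \<psi>)"

section \<open>Local backbones\<close>

text \<open>A literal \<open>l\<close> on the right of an entailment is the unit formula \<open>{{l}}\<close>.
  As \<open>x\<close> may have disappeared from an iterated reduct, membership of \<open>x\<close> in \<open>vars \<phi>\<close>
  is not part of these two notions; it is demanded of problem instances below.\<close>

definition k_backbone :: "nat \<Rightarrow> 'v formula \<Rightarrow> 'v \<Rightarrow> bool" where
  "k_backbone k \<phi> x \<longleftrightarrow>
     (\<exists>\<phi>'. \<phi>' \<subseteq> \<phi> \<and> finite \<phi>' \<and> card \<phi>' \<le> k \<and>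
        (entails \<phi>' {{Pos x}} \<or> entails \<phi>' {{Neg x}}))"

inductive iterative_k_backbone :: "nat \<Rightarrow> 'v formula \<Rightarrow> 'v \<Rightarrow> bool" for k where
  base: "k_backbone k \<phi> x \<Longrightarrow> iterative_k_backbone k \<phi> x"
| step: "\<lbrakk>y \<in> vars \<phi>; k_backbone k \<phi> y; l \<in> {Pos y, Neg y}; entails \<phi> {{l}};
          iterative_k_backbone k (reduct \<phi> l) x\<rbrakk>
         \<Longrightarrow> iterative_k_backbone k \<phi> x"

section \<open>Polynomial time\<close>

text \<open>The machine model is the random access machine of Cook and Reckhow, over the natural
  numbers with truncated subtraction, under the uniform cost criterion. There is no
  multiplication, so registers hold numbers of at most linearly many bits in the number of
  steps (plus the length of the input), and polynomial time agrees with polynomial time on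
  Turing machines. Below \<open>X\<^sub>i\<close> is the content of register \<open>i\<close>.

  The input is a read-only word: \<open>Input i j\<close> puts into \<open>X\<^sub>i\<close> the symbol at
  position \<open>X\<^sub>j\<close>, coded as 1 (\<open>False\<close>) or 2 (\<open>True\<close>), or 0 beyond the end of the word.\<close>

datatype instr =
    Const nat nat      \<comment> \<open>\<open>Const i c\<close>: \<open>X\<^sub>i := c\<close>\<close>
  | Add nat nat nat    \<comment> \<open>\<open>Add i j k\<close>: \<open>X\<^sub>i := X\<^sub>j + X\<^sub>k\<close>\<close>
  | Sub nat nat nat    \<comment> \<open>\<open>Sub i j k\<close>: \<open>X\<^sub>i := X\<^sub>j - X\<^sub>k\<close>\<close>
  | Load nat nat       \<comment> \<open>\<open>Load i j\<close>: \<open>X\<^sub>i\<close> := content of register \<open>X\<^sub>j\<close>\<close>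
  | Store nat nat      \<comment> \<open>\<open>Store i j\<close>: register \<open>X\<^sub>i\<close> := \<open>X\<^sub>j\<close>\<close>
  | Input nat nat
  | Jump nat nat       \<comment> \<open>\<open>Jump i m\<close>: continue at instruction \<open>m\<close> if \<open>X\<^sub>i > 0\<close>\<close>

type_synonym config = "nat \<times> (nat \<Rightarrow> nat)"

definition input_symbol :: "bool list \<Rightarrow> nat \<Rightarrow> nat" where
  "input_symbol w p = (if p < length w then (if w ! p then 2 else 1) else 0)"

fun exec :: "bool list \<Rightarrow> instr \<Rightarrow> config \<Rightarrow> config" where
  "exec w (Const i c) (pc, X) = (Suc pc, X(i := c))"
| "exec w (Add i j k) (pc, X) = (Suc pc, X(i := X j + X k))"
| "exec w (Sub i j k) (pc, X) = (Suc pc, X(i := X j - X k))"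
| "exec w (Load i j) (pc, X) = (Suc pc, X(i := X (X j)))"
| "exec w (Store i j) (pc, X) = (Suc pc, X(X i := X j))"
| "exec w (Input i j) (pc, X) = (Suc pc, X(i := input_symbol w (X j)))"
| "exec w (Jump i m) (pc, X) = (if X i > 0 then m else Suc pc, X)"

definition halted :: "instr list \<Rightarrow> config \<Rightarrow> bool" where
  "halted P c \<longleftrightarrow> length P \<le> fst c"

definition ram_step :: "instr list \<Rightarrow> bool list \<Rightarrow> config \<Rightarrow> config" where
  "ram_step P w c = (if halted P c then c else exec w (P ! fst c) c)"

definition run :: "instr list \<Rightarrow> bool list \<Rightarrow> nat \<Rightarrow> config" where
  "run P w t = (ram_step P w ^^ t) (0, \<lambda>_. 0)"

text \<open>The answer of a halted machine is read off register 0. Halted configurations are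
  fixed points of \<open>ram_step\<close>, so running for exactly the time bound loses nothing.\<close>

definition decides_in_time :: "instr list \<Rightarrow> bool list set \<Rightarrow> (nat \<Rightarrow> nat) \<Rightarrow> bool" where
  "decides_in_time P L T \<longleftrightarrow>
     (\<forall>w. halted P (run P w (T (length w))) \<and>
          (snd (run P w (T (length w))) 0 > 0 \<longleftrightarrow> w \<in> L))"

definition polynomial_time :: "bool list set set" where
  "polynomial_time = {L. \<exists>P (p :: nat poly). decides_in_time P L (poly p)}"

section \<open>The decision problem\<close>

text \<open>Instances are binary words in a self-delimiting encoding; numbers (variable names and
  \<open>k\<close>) are written in binary, least significant bit first, without leading zeros.\<close>

definition enc_list :: "('a \<Rightarrow> bool list) \<Rightarrow> 'a list \<Rightarrow> bool list" where
  "enc_list f xs = concat (map (\<lambda>x. True # f x) xs) @ [False]"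

fun bits_of :: "nat \<Rightarrow> bool list" where
  "bits_of n = (if n = 0 then [] else odd n # bits_of (n div 2))"

declare bits_of.simps [simp del]

definition enc_nat :: "nat \<Rightarrow> bool list" where
  "enc_nat n = enc_list (\<lambda>b. [b]) (bits_of n)"

fun enc_lit :: "nat lit \<Rightarrow> bool list" where
  "enc_lit (Pos x) = True # enc_nat x"
| "enc_lit (Neg x) = False # enc_nat x"

definition enc_instance :: "nat lit list list \<Rightarrow> nat \<Rightarrow> nat \<Rightarrow> bool list" where
  "enc_instance cs x k = enc_list (enc_list enc_lit) cs @ enc_nat x @ enc_nat k"

text \<open>A formula is written down as any list of clauses, each given as any list of literals,
  that enumerates it; order and repetitions are immaterial.\<close>

definition formula_of :: "'v lit list list \<Rightarrow> 'v formula" where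
  "formula_of cs = set ` set cs"

definition iterative_local_backbone :: "nat formula set \<Rightarrow> bool list set" where
  "iterative_local_backbone \<C> =
     {enc_instance cs x k | cs x k.
        cnf (formula_of cs) \<and> formula_of cs \<in> \<C> \<and> x \<in> vars (formula_of cs) \<and> 1 \<le> k \<and>
        iterative_k_backbone k (formula_of cs) x}"

end

theory Submission
  imports Defs
begin

text \<open>In a satisfiable Krom formula, \<open>l\<close> is entailed iff its implication graph has a walk from the
  complement of \<open>l\<close> to \<open>l\<close>. The number of clauses of a smallest entailing subformula is not the
  length of a shortest such walk, since a walk may use a clause in both directions; but then the part
  of the walk in between derives another literal, with fewer clauses, from which \<open>l\<close> can be reached.
  As iteration amounts to following edges from derived literals, \<open>x\<close> is an iterative \<open>k\<close>-backbone of
  \<open>\<phi>\<close> iff \<open>\<phi>\<close> contains the empty clause, or some literal \<open>m\<close> has distance at most \<open>k\<close> from its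
  complement and either \<open>m\<close> reaches a literal of \<open>x\<close> or \<open>\<phi>\<close> is contradictory. (If \<open>\<phi>\<close> is
  unsatisfiable, then it also entails the complement of \<open>m\<close>, and reducing by this makes every variable
  a \<open>k\<close>-backbone.) Shortest distances are computed by Bellman--Ford, with loops that run once per
  input symbol, so that polynomial time is a matter of syntax.\<close>

section \<open>Iterative local backbones of Krom formulas\<close>

text \<open>Reducing by a derived literal \<open>m\<close> turns a clause
  \<open>{compl m, b}\<close> into the unit clause \<open>{b}\<close>, which is a witness of size 1.
  So only the start of a chain of derivations is limited by \<open>k\<close>, and its continuation
  is plain reachability. Conversely, a clause of a Krom formula that is shortened by reducing
  becomes unit or empty, so all new edges of a reduct lead to literals that could already be
  reached. The empty clause has no edge and is treated separately. On the machine, variable names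
  and \<open>k\<close> are written in binary and can be exponential in the input length, so neither
  may drive a loop: \<open>k\<close> is only compared with a computed distance, and an array of
  distances is reset only at the endpoints of edges. A clause takes at least two input symbols and
  yields at most two edges, so one pass over the input positions is enough to visit every
  edge.\<close>

lemma compl_compl [simp]: "compl (compl l) = l"
  by (cases l) auto

lemma compl_neq [simp]: "compl l \<noteq> l" "l \<noteq> compl l"
  by (cases l; simp)+

lemma compl_eq_iff [simp]: "compl a = compl b \<longleftrightarrow> a = b"
  by (metis compl_compl)

lemma var_of_compl [simp]: "var_of (compl l) = var_of l"
  by (cases l) auto

lemma var_of_eq_iff: "var_of a = var_of b \<longleftrightarrow> a = b \<or> a = compl b"
  by (cases a; cases b) auto

lemma sat_lit_compl [simp]: "sat_lit \<alpha> (compl l) \<longleftrightarrow> \<not> sat_lit \<alpha> l"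
  by (cases l) auto

lemma satisfies_unit [simp]: "satisfies \<alpha> {{l}} \<longleftrightarrow> sat_lit \<alpha> l"
  by (simp add: satisfies_def)

lemma satisfies_mono: "satisfies \<alpha> \<phi> \<Longrightarrow> \<psi> \<subseteq> \<phi> \<Longrightarrow> satisfies \<alpha> \<psi>"
  by (auto simp: satisfies_def)

section \<open>Implication graph and satisfiability\<close>

definition satisfiable :: "'v formula \<Rightarrow> bool" where
  "satisfiable \<phi> \<longleftrightarrow> (\<exists>\<alpha>. satisfies \<alpha> \<phi>)"

lemma not_satisfiable_empty_clause: "{} \<in> \<phi> \<Longrightarrow> \<not> satisfiable \<phi>"
  by (auto simp: satisfiable_def satisfies_def)

text \<open>A unit clause \<open>{b}\<close> is the edge from \<open>compl b\<close> to \<open>b\<close>.\<close>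

definition edge :: "'v formula \<Rightarrow> 'v lit \<Rightarrow> 'v lit \<Rightarrow> bool" where
  "edge \<phi> a b \<longleftrightarrow> {compl a, b} \<in> \<phi>"

lemma edge_compl: "edge \<phi> a b \<Longrightarrow> edge \<phi> (compl b) (compl a)"
  by (simp add: edge_def insert_commute)

lemma edge_mono: "edge \<psi> a b \<Longrightarrow> \<psi> \<subseteq> \<phi> \<Longrightarrow> edge \<phi> a b"
  by (auto simp: edge_def)

lemma reach_mono: "(edge \<psi>)\<^sup>*\<^sup>* a b \<Longrightarrow> \<psi> \<subseteq> \<phi> \<Longrightarrow> (edge \<phi>)\<^sup>*\<^sup>* a b"
  by (metis edge_mono mono_rtranclp)

lemma relpowp_edge_mono: "(edge \<psi> ^^ n) a b \<Longrightarrow> \<psi> \<subseteq> \<phi> \<Longrightarrow> (edge \<phi> ^^ n) a b"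
  by (metis edge_mono relpowp_mono)

lemma reach_compl: "(edge \<phi>)\<^sup>*\<^sup>* a b \<Longrightarrow> (edge \<phi>)\<^sup>*\<^sup>* (compl b) (compl a)"
  by (induction rule: rtranclp_induct) (auto intro: edge_compl converse_rtranclp_into_rtranclp)

lemma sat_lit_reach: "(edge \<phi>)\<^sup>*\<^sup>* a b \<Longrightarrow> satisfies \<alpha> \<phi> \<Longrightarrow> sat_lit \<alpha> a \<Longrightarrow> sat_lit \<alpha> b"
proof (induction rule: rtranclp_induct)
  case (step y z)
  then show ?case unfolding edge_def satisfies_def
    by (metis insertE sat_lit_compl singletonD)
qed

definition contradictory :: "'v formula \<Rightarrow> bool" where
  "contradictory \<phi> \<longleftrightarrow> (\<exists>p. (edge \<phi>)\<^sup>*\<^sup>* p (compl p) \<and> (edge \<phi>)\<^sup>*\<^sup>* (compl p) p)"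

lemma not_satisfiable_contradictory: "contradictory \<phi> \<Longrightarrow> \<not> satisfiable \<phi>"
  unfolding contradictory_def satisfiable_def by (metis sat_lit_compl sat_lit_reach)

lemma krom_clauseD:
  assumes "\<phi> \<in> krom" "C \<in> \<phi>" "C \<noteq> {}"
  obtains a b where "C = {a, b}"
proof -
  have "finite C" "card C \<le> 2"
    using assms by (auto simp: krom_def cnf_def is_clause_def)
  moreover have "card C \<noteq> 0"
    using assms \<open>finite C\<close> by simp
  ultimately have "card C = 1 \<or> card C = 2" by linarith
  then show ?thesis
    by (metis that card_1_singletonE card_2_iff insert_absorb2)
qed

text \<open>By Zorn's lemma \<open>S\<close> lies in a maximal set \<open>M\<close> of literals that
  is closed under edges and free of complementary pairs. Maximality makes \<open>M\<close> contain a
  literal of every variable, so it is an assignment, and closure under edges makes each clause true.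
  Empty \<open>S\<close> gives satisfiability; other choices refute an entailment.\<close>

lemma satisfiable_extension:
  assumes "\<phi> \<in> krom" "{} \<notin> \<phi>" "\<not> contradictory \<phi>"
    and closed: "\<And>a b. a \<in> S \<Longrightarrow> edge \<phi> a b \<Longrightarrow> b \<in> S"
    and cons: "\<And>a. a \<in> S \<Longrightarrow> compl a \<notin> S"
  obtains \<alpha> where "satisfies \<alpha> \<phi>" "\<And>a. a \<in> S \<Longrightarrow> sat_lit \<alpha> a"
proof -
  define good where
    "good T \<longleftrightarrow> S \<subseteq> T \<and> (\<forall>a b. a \<in> T \<longrightarrow> edge \<phi> a b \<longrightarrow> b \<in> T) \<and> (\<forall>a\<in>T. compl a \<notin> T)" for T
  have "\<exists>M\<in>Collect good. \<forall>X\<in>Collect good. M \<subseteq> X \<longrightarrow> X = M"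
  proof (rule subset_Zorn_nonempty)
    show "Collect good \<noteq> {}"
      using closed cons by (auto simp: good_def)
  next
    fix \<C> assume "\<C> \<noteq> {}" and ch: "subset.chain (Collect good) \<C>"
    have g: "T \<in> \<C> \<Longrightarrow> good T" for T
      using ch by (auto simp: subset.chain_def)
    have "good (\<Union>\<C>)"
      unfolding good_def
    proof (intro conjI ballI allI impI)
      show "S \<subseteq> \<Union>\<C>" using \<open>\<C> \<noteq> {}\<close> g by (fastforce simp: good_def)
      show "b \<in> \<Union>\<C>" if "a \<in> \<Union>\<C>" "edge \<phi> a b" for a b
        using that g by (fastforce simp: good_def)
      fix a assume "a \<in> \<Union>\<C>"
      then obtain T where T: "T \<in> \<C>" "a \<in> T" by blast
      show "compl a \<notin> \<Union>\<C>"
      proof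
        assume "compl a \<in> \<Union>\<C>"
        then obtain U where U: "U \<in> \<C>" "compl a \<in> U" by blast
        have "T \<subseteq> U \<or> U \<subseteq> T"
          using ch T U by (auto simp: subset.chain_def)
        then show False
          using T U g by (metis good_def subsetD)
      qed
    qed
    then show "\<Union>\<C> \<in> Collect good" by simp
  qed
  then obtain M where M: "good M" and max: "\<And>X. good X \<Longrightarrow> M \<subseteq> X \<Longrightarrow> X = M" by auto
  have reachM: "b \<in> M" if "(edge \<phi>)\<^sup>*\<^sup>* a b" "a \<in> M" for a b
    using that by (induction rule: rtranclp_induct) (use M in \<open>auto simp: good_def\<close>)
  have total: "compl p \<in> M" if "p \<notin> M" for p
  proof (rule ccontr)
    assume np: "compl p \<notin> M"
    \<comment> \<open>Adding to \<open>M\<close> everything reachable from \<open>q\<close> keeps it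
      closed. A clash with \<open>M\<close> would, by a contraposed walk, put \<open>compl q\<close>
      into \<open>M\<close>; a clash among the new literals gives a walk from \<open>q\<close> to
      \<open>compl q\<close>. Applied to \<open>p\<close> and \<open>compl p\<close>, this yields a
      contradiction in the graph.\<close>
    have *: "q \<in> M \<or> (edge \<phi>)\<^sup>*\<^sup>* q (compl q)" if "compl q \<notin> M" for q
    proof (rule ccontr)
      assume neg: "\<not> ?thesis"
      let ?X = "M \<union> {r. (edge \<phi>)\<^sup>*\<^sup>* q r}"
      have "compl a \<notin> ?X" if a: "a \<in> ?X" for a
      proof
        assume ca: "compl a \<in> ?X"
        consider "a \<in> M" "compl a \<in> M" | "a \<in> M" "(edge \<phi>)\<^sup>*\<^sup>* q (compl a)"
          | "(edge \<phi>)\<^sup>*\<^sup>* q a" "compl a \<in> M" | "(edge \<phi>)\<^sup>*\<^sup>* q a" "(edge \<phi>)\<^sup>*\<^sup>* q (compl a)"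
          using a ca by blast
        then show False
        proof cases
          case 1 then show ?thesis using M by (auto simp: good_def)
        next
          case 2
          then show ?thesis using reach_compl[OF 2(2)] reachM \<open>compl q \<notin> M\<close> by auto
        next
          case 3
          then show ?thesis using reach_compl[OF 3(1)] reachM \<open>compl q \<notin> M\<close> by auto
        next
          case 4
          then show ?thesis using reach_compl[OF 4(2)] neg by (auto dest: rtranclp_trans)
        qed
      qed
      then have "good ?X"
        using M by (auto simp: good_def intro: rtranclp.rtrancl_into_rtrancl)
      then have "?X = M" using max by blast
      then show False using neg by auto
    qed
    have "(edge \<phi>)\<^sup>*\<^sup>* p (compl p)" "(edge \<phi>)\<^sup>*\<^sup>* (compl p) p"
      using *[of p] *[of "compl p"] that np by auto
    then show False using assms(3) by (auto simp: contradictory_def)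
  qed
  define \<alpha> where "\<alpha> v \<longleftrightarrow> Pos v \<in> M" for v
  have sat: "sat_lit \<alpha> a \<longleftrightarrow> a \<in> M" for a
    using total[of a] total[of "compl a"] M by (cases a) (auto simp: \<alpha>_def good_def)
  have "satisfies \<alpha> \<phi>"
    unfolding satisfies_def
  proof
    fix C assume C: "C \<in> \<phi>"
    then obtain a b where ab: "C = {a, b}"
      using assms krom_clauseD by metis
    have "edge \<phi> (compl a) b" using C ab by (simp add: edge_def)
    then have "a \<in> M \<or> b \<in> M"
      using total[of a] M by (auto simp: good_def)
    then show "\<exists>l\<in>C. sat_lit \<alpha> l" using ab sat by auto
  qed
  then show ?thesis
    using that sat M by (auto simp: good_def)
qed

lemma satisfiable_krom_iff:
  assumes "\<phi> \<in> krom" "{} \<notin> \<phi>"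
  shows "satisfiable \<phi> \<longleftrightarrow> \<not> contradictory \<phi>"
  using satisfiable_extension[OF assms, of "{}"] not_satisfiable_contradictory
  by (metis empty_iff satisfiable_def)

text \<open>Without such a walk, the literals reachable from \<open>compl l\<close> contain no
  complementary pair, since by contraposition such a pair would lead on to \<open>l\<close>. They
  extend to a model in which \<open>l\<close> is false.\<close>

lemma entails_lit_reach:
  assumes "\<phi> \<in> krom" "satisfiable \<phi>" "entails \<phi> {{l}}"
  shows "(edge \<phi>)\<^sup>*\<^sup>* (compl l) l"
proof (rule ccontr)
  assume neg: "\<not> ?thesis"
  have "{} \<notin> \<phi>" "\<not> contradictory \<phi>"
    using assms not_satisfiable_empty_clause not_satisfiable_contradictory by blast+
  then obtain \<alpha> where \<alpha>: "satisfies \<alpha> \<phi>" "\<And>a. (edge \<phi>)\<^sup>*\<^sup>* (compl l) a \<Longrightarrow> sat_lit \<alpha> a"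
  proof (rule satisfiable_extension[OF assms(1), of "{a. (edge \<phi>)\<^sup>*\<^sup>* (compl l) a}"])
    fix a assume "a \<in> {a. (edge \<phi>)\<^sup>*\<^sup>* (compl l) a}"
    then show "compl a \<notin> {a. (edge \<phi>)\<^sup>*\<^sup>* (compl l) a}"
      using neg reach_compl[of \<phi> "compl l" "compl a"] by (auto dest: rtranclp_trans)
  qed (auto intro: rtranclp.rtrancl_into_rtrancl)
  from \<alpha>(2)[of "compl l"] have "sat_lit \<alpha> (compl l)" by simp
  moreover from \<alpha>(1) assms(3) have "sat_lit \<alpha> l" by (simp add: entails_def)
  ultimately
  show False by simp
qed

section \<open>Walks of bounded length and local backbones\<close>

lemma relpowp_fun_segment:
  assumes "\<And>i. i < n \<Longrightarrow> R (f i) (f (Suc i))" "i \<le> j" "j \<le> (n::nat)"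
  shows "(R ^^ (j - i)) (f i) (f j)"
  unfolding relpowp_fun_conv
  using assms by (intro exI[of _ "\<lambda>t. f (i + t)"]) auto

text \<open>A shortest walk from \<open>compl m\<close> to \<open>m\<close> never uses a clause twice in the same direction,
  and if it uses one in both directions, then the part in between is itself such a walk, for a
  literal from which \<open>m\<close> can be reached.\<close>

lemma short_self_implication:
  assumes "finite \<phi>"
  shows "(edge \<phi> ^^ n) (compl m) m \<Longrightarrow>
    \<exists>m' n'. n' \<le> card \<phi> \<and> (edge \<phi> ^^ n') (compl m') m' \<and> (edge \<phi>)\<^sup>*\<^sup>* m' m"
proof (induction n arbitrary: m rule: less_induct)
  case (less n)
  show ?case
  proof (cases "n \<le> card \<phi>")
    case True
    then show ?thesis using less.prems by blast
  next
    case False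
    obtain f where f: "f 0 = compl m" "f n = m" and E: "\<And>i. i < n \<Longrightarrow> edge \<phi> (f i) (f (Suc i))"
      using less.prems by (auto simp: relpowp_fun_conv)
    note seg = relpowp_fun_segment[of n "edge \<phi>" f, OF E]
    let ?g = "\<lambda>i. {compl (f i), f (Suc i)}"
    have "?g ` {..<n} \<subseteq> \<phi>"
      using E by (auto simp: edge_def)
    then have "\<not> inj_on ?g {..<n}"
      using False assms card_inj_on_le[of ?g "{..<n}" \<phi>] by auto
    then obtain i j where ij: "i < j" "j < n" "?g i = ?g j"
      unfolding linorder_inj_onI'[of "{..<n}" ?g]
      by (metis (no_types, lifting) inj_onI lessThan_iff linorder_neqE_nat)
    then consider "f i = f j" | "f (Suc i) = compl (f j)"
      by (auto simp: doubleton_eq_iff)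
    then show ?thesis
    proof cases
      case 1
      have "(edge \<phi> ^^ (i + (n - j))) (compl m) m"
        using relpowp_trans[OF seg[of 0 i] seg[of j n, folded 1]] f ij by auto
      moreover have "i + (n - j) < n" using ij by linarith
      ultimately show ?thesis using less.IH by blast
    next
      case 2
      have "(edge \<phi> ^^ (j - Suc i)) (compl (f j)) (f j)"
        using seg[of "Suc i" j] ij 2 by auto
      moreover have "j - Suc i < n" using ij by linarith
      ultimately obtain m' n' where "n' \<le> card \<phi>" "(edge \<phi> ^^ n') (compl m') m'"
          "(edge \<phi>)\<^sup>*\<^sup>* m' (f j)"
        using less.IH by blast
      moreover have "(edge \<phi>)\<^sup>*\<^sup>* (f j) m"
        using seg[of j n] ij f by (metis less_imp_le order_refl relpowp_imp_rtranclp)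
      ultimately show ?thesis by (meson rtranclp_trans)
    qed
  qed
qed

lemma krom_subset: "\<psi> \<subseteq> \<phi> \<Longrightarrow> \<phi> \<in> krom \<Longrightarrow> \<psi> \<in> krom"
  by (auto simp: krom_def cnf_def intro: finite_subset)

text \<open>A witness \<open>\<psi>\<close> with at most \<open>k\<close> clauses supplies the walk.
  If \<open>\<psi>\<close> is satisfiable, shortening may replace \<open>l\<close> by another
  literal \<open>m\<close>, from which \<open>l\<close> is reached. If not, \<open>\<psi>\<close>
  says nothing about \<open>x\<close> in particular, but its contradiction still yields a short
  walk; hence the link to \<open>x\<close> is promised only for satisfiable
  \<open>\<phi>\<close>.\<close>

lemma k_backbone_walk:
  assumes "\<phi> \<in> krom" "k_backbone k \<phi> x" "{} \<notin> \<phi>"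
  obtains m n where "n \<le> k" "(edge \<phi> ^^ n) (compl m) m"
    "satisfiable \<phi> \<Longrightarrow> \<exists>l. var_of l = x \<and> entails \<phi> {{l}} \<and> (edge \<phi>)\<^sup>*\<^sup>* m l"
proof -
  obtain \<psi> l where \<psi>: "\<psi> \<subseteq> \<phi>" "finite \<psi>" "card \<psi> \<le> k" and l: "var_of l = x" "entails \<psi> {{l}}"
    using assms(2) unfolding k_backbone_def by (metis var_of.simps)
  have kr: "\<psi> \<in> krom" using krom_subset assms \<psi> by blast
  have ent: "entails \<phi> {{l}}" using l \<psi> by (auto simp: entails_def dest: satisfies_mono)
  show ?thesis
  proof (cases "satisfiable \<psi>")
    case True
    then obtain n where "(edge \<psi> ^^ n) (compl l) l"
      using entails_lit_reach[OF kr True l(2)] by (auto simp: rtranclp_power)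
    from short_self_implication[OF \<psi>(2) this] obtain m n'
      where *: "n' \<le> card \<psi>" "(edge \<psi> ^^ n') (compl m) m" "(edge \<psi>)\<^sup>*\<^sup>* m l" by blast
    show ?thesis
    proof (rule that[of n' m])
      show "n' \<le> k" using * \<psi> by simp
      show "(edge \<phi> ^^ n') (compl m) m" using * \<psi> relpowp_edge_mono by blast
      show "\<exists>l. var_of l = x \<and> entails \<phi> {{l}} \<and> (edge \<phi>)\<^sup>*\<^sup>* m l"
        using l ent reach_mono[OF *(3) \<psi>(1)] by blast
    qed
  next
    case False
    then obtain p where "(edge \<psi>)\<^sup>*\<^sup>* (compl p) p"
      using satisfiable_krom_iff[OF kr] \<psi> assms(3) by (auto simp: contradictory_def)
    then obtain n where "(edge \<psi> ^^ n) (compl p) p"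
      by (auto simp: rtranclp_power)
    from short_self_implication[OF \<psi>(2) this] obtain m n'
      where *: "n' \<le> card \<psi>" "(edge \<psi> ^^ n') (compl m) m" by blast
    moreover have "\<not> satisfiable \<phi>"
      using False \<psi> by (auto simp: satisfiable_def dest: satisfies_mono)
    ultimately show ?thesis
      using that[of n' m] \<psi> relpowp_edge_mono by (metis order_trans)
  qed
qed

section \<open>Reducts of Krom formulas\<close>

lemma satisfies_reduct: "sat_lit \<alpha> l \<Longrightarrow> satisfies \<alpha> \<phi> \<Longrightarrow> satisfies \<alpha> (reduct \<phi> l)"
  unfolding satisfies_def reduct_def by (fastforce simp: sat_lit_compl)

lemma satisfiable_reduct: "satisfiable \<phi> \<Longrightarrow> entails \<phi> {{l}} \<Longrightarrow> satisfiable (reduct \<phi> l)"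
  by (auto simp: satisfiable_def entails_def intro: satisfies_reduct)

lemma finite_reduct: "finite \<phi> \<Longrightarrow> finite (reduct \<phi> l) \<and> card (reduct \<phi> l) \<le> card \<phi>"
proof -
  assume fin: "finite \<phi>"
  have *: "reduct \<phi> l \<subseteq> (\<lambda>C. C - {compl l}) ` \<phi>" by (auto simp: reduct_def)
  show ?thesis
    using finite_subset[OF *] card_mono[OF _ *] card_image_le[OF fin] fin
    by (meson finite_imageI order_trans)
qed

lemma krom_reduct: "\<phi> \<in> krom \<Longrightarrow> reduct \<phi> l \<in> krom"
  using finite_reduct[of \<phi> l]
  by (fastforce simp: krom_def cnf_def is_clause_def reduct_def
      intro: order_trans[OF card_mono[OF _ Diff_subset]])

text \<open>A clause that loses \<open>compl l\<close> keeps at most one literal, so an edge it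
  provides is that of a unit clause \<open>{b}\<close> and comes from \<open>{compl l, b}\<close>,
  the edge from \<open>l\<close> to \<open>b\<close>. Here the bound of two literals is
  decisive.\<close>

lemma edge_reductD:
  assumes "\<phi> \<in> krom" "edge (reduct \<phi> l) a b"
  shows "edge \<phi> a b \<or> edge \<phi> l b"
proof -
  obtain C where C: "C \<in> \<phi>" "{compl a, b} = C - {compl l}"
    using assms by (auto simp: edge_def reduct_def)
  show ?thesis
  proof (cases "compl l \<in> C")
    case True
    then have CC: "C = {compl l, compl a, b}" using C(2) by auto
    moreover have "compl l \<noteq> compl a" "compl l \<noteq> b" using C(2) by auto
    moreover have "card C \<le> 2" using C(1) assms by (auto simp: krom_def)
    ultimately have "compl a = b" by (auto simp: card_insert_if split: if_splits)
    then show ?thesis using C CC by (auto simp: edge_def)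
  next
    case False
    then show ?thesis using C by (simp add: edge_def)
  qed
qed

text \<open>New edges stand for edges out of \<open>l\<close>: once a walk uses one, its current
  vertex is reachable from \<open>l\<close>, hence from \<open>m\<close>, and all later vertices are
  too. Otherwise it is a walk in \<open>\<phi>\<close> of the same length, as needed for the
  comparison with \<open>k\<close>.\<close>

lemma relpowp_reductD:
  assumes "\<phi> \<in> krom" "(edge \<phi>)\<^sup>*\<^sup>* m l"
  shows "(edge (reduct \<phi> l) ^^ n) p q \<Longrightarrow> (edge \<phi> ^^ n) p q \<or> (edge \<phi>)\<^sup>*\<^sup>* m q"
proof (induction n arbitrary: q)
  case (Suc n)
  then obtain r where r: "(edge (reduct \<phi> l) ^^ n) p r" "edge (reduct \<phi> l) r q" by auto
  with edge_reductD[OF assms(1) r(2)] Suc.IH[OF r(1)] assms(2) show ?case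
    by (auto intro: rtranclp.rtrancl_into_rtrancl)
qed auto

section \<open>From walks back to iterative backbones\<close>

lemma walk_entails:
  assumes "(edge \<phi> ^^ n) (compl m) m"
  obtains \<psi> where "\<psi> \<subseteq> \<phi>" "finite \<psi>" "card \<psi> \<le> n" "entails \<psi> {{m}}"
proof -
  obtain f where f: "f 0 = compl m" "f n = m" and E: "\<And>i. i < n \<Longrightarrow> edge \<phi> (f i) (f (Suc i))"
    using assms by (auto simp: relpowp_fun_conv)
  \<comment> \<open>Indexing the clauses by positions on the walk bounds their number by
    \<open>n\<close>, whether or not some recur.\<close>
  let ?\<psi> = "(\<lambda>i. {compl (f i), f (Suc i)}) ` {..<n}"
  have "(edge ?\<psi> ^^ n) (compl m) m"
    unfolding relpowp_fun_conv using f by (intro exI[of _ f]) (auto simp: edge_def)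
  then have "(edge ?\<psi>)\<^sup>*\<^sup>* (compl m) m" by (rule relpowp_imp_rtranclp)
  from sat_lit_reach[OF this] have "entails ?\<psi> {{m}}"
    unfolding entails_def satisfies_unit by (auto simp only: sat_lit_compl)
  moreover have "?\<psi> \<subseteq> \<phi>" using E by (auto simp: edge_def)
  moreover have "card ?\<psi> \<le> n" using card_image_le[of "{..<n}"] by fastforce
  ultimately show ?thesis using that by blast
qed

text \<open>\<open>k_backbone\<close> with the polarity fixed, as iteration has to know which
  literal is derived.\<close>

definition k_entails :: "nat \<Rightarrow> 'v formula \<Rightarrow> 'v lit \<Rightarrow> bool" where
  "k_entails k \<phi> l \<longleftrightarrow> (\<exists>\<psi>\<subseteq>\<phi>. finite \<psi> \<and> card \<psi> \<le> k \<and> entails \<psi> {{l}})"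

lemma k_entails_imp: "k_entails k \<phi> l \<Longrightarrow> k_backbone k \<phi> (var_of l) \<and> entails \<phi> {{l}}"
  unfolding k_entails_def k_backbone_def entails_def
  by (cases l) (auto, (metis satisfies_mono)+)

text \<open>Iteration follows the walk edge by edge. Reducing by \<open>m\<close> turns the first
  clause \<open>{compl m, f 1}\<close> into the unit clause of \<open>f 1\<close>, a witness of size
  1 \<le> k. The other clauses of the walk survive unless they mention the variable of
  \<open>m\<close>: satisfiability keeps \<open>compl m\<close> off the walk, and a return to
  \<open>m\<close> shortens it.\<close>

lemma iterative_k_backbone_reach:
  assumes "1 \<le> k"
  shows "satisfiable \<phi> \<Longrightarrow> k_entails k \<phi> m \<Longrightarrow> (edge \<phi> ^^ n) m l \<Longrightarrow>
    iterative_k_backbone k \<phi> (var_of l)"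
proof (induction n arbitrary: \<phi> m rule: less_induct)
  case (less n)
  obtain f where f: "f 0 = m" "f n = l" and E: "\<And>i. i < n \<Longrightarrow> edge \<phi> (f i) (f (Suc i))"
    using less.prems by (auto simp: relpowp_fun_conv)
  note seg = relpowp_fun_segment[of n "edge \<phi>" f, OF E]
  note m = k_entails_imp[OF less.prems(2)]
  show ?case
  proof (cases "n = 0")
    case True
    then show ?thesis using m f by (auto intro: iterative_k_backbone.base)
  next
    case False
    show ?thesis
    proof (cases "\<exists>i\<in>{0<..n}. f i = m")
      case True
      then obtain i where i: "0 < i" "i \<le> n" "f i = m" by auto
      then show ?thesis
        using less.IH[of "n - i" \<phi> m] seg[of i n] less.prems f by auto
    next
      case no_m: False
      have no_cm: "f i \<noteq> compl m" if "i \<le> n" for i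
      proof
        assume eq: "f i = compl m"
        have "(edge \<phi>)\<^sup>*\<^sup>* m (compl m)"
          using seg[of 0 i] that f eq by (auto dest: relpowp_imp_rtranclp)
        moreover obtain \<alpha> where "satisfies \<alpha> \<phi>" "sat_lit \<alpha> m"
          using less.prems m by (auto simp: satisfiable_def entails_def)
        ultimately show False using sat_lit_reach sat_lit_compl by blast
      qed
      let ?\<rho> = "reduct \<phi> m"
      have "(edge ?\<rho> ^^ (n - 1)) (f 1) l"
        unfolding relpowp_fun_conv
      proof (intro exI[of _ "\<lambda>i. f (Suc i)"] conjI allI impI)
        fix i assume i: "i < n - 1"
        let ?C = "{compl (f (Suc i)), f (Suc (Suc i))}"
        have "?C \<in> \<phi>" using E[of "Suc i"] i by (simp add: edge_def)
        moreover have "m \<notin> ?C" "compl m \<notin> ?C"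
          using no_m no_cm[of "Suc i"] no_cm[of "Suc (Suc i)"] i by force+
        ultimately have "?C \<in> ?\<rho>" unfolding reduct_def by blast
        then show "edge ?\<rho> (f (Suc i)) (f (Suc (Suc i)))" by (simp add: edge_def)
      qed (use f False in auto)
      moreover have "k_entails k ?\<rho> (f 1)"
      proof -
        have "{compl m, f 1} \<in> \<phi>" using E[of 0] f False by (auto simp: edge_def)
        moreover have "m \<notin> {compl m, f 1}" "{compl m, f 1} - {compl m} = {f 1}"
          using no_m no_cm[of 1] False by auto
        ultimately have "{f 1} \<in> ?\<rho>" unfolding reduct_def by (smt (verit) mem_Collect_eq)
        then show ?thesis
          unfolding k_entails_def using assms by (intro exI[of _ "{{f 1}}"]) (auto simp: entails_def)
      qed
      ultimately have "iterative_k_backbone k ?\<rho> (var_of l)"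
        using less.IH[of "n - 1" ?\<rho> "f 1"] False less.prems m satisfiable_reduct by auto
      moreover have "var_of m \<in> vars \<phi>"
        using E[of 0] f False unfolding edge_def vars_def
        by (metis UnionI bot_nat_0.not_eq_extremum image_eqI insertI1 var_of_compl)
      ultimately show ?thesis
        using m by (cases m) (auto intro: iterative_k_backbone.step)
    qed
  qed
qed

text \<open>Reducing the witness by \<open>compl m\<close> leaves an unsatisfiable formula: a model
  could be changed at the variable of \<open>m\<close> to make \<open>compl m\<close> true and
  satisfy the witness. It still has at most \<open>k\<close> clauses and entails every literal, even
  of variables that have vanished.\<close>

lemma k_entails_reduct_compl:
  assumes "k_entails k \<phi> m"
  shows "k_backbone k (reduct \<phi> (compl m)) x"
proof -
  obtain \<psi> where \<psi>: "\<psi> \<subseteq> \<phi>" "finite \<psi>" "card \<psi> \<le> k" "entails \<psi> {{m}}"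
    using assms by (auto simp: k_entails_def)
  let ?\<rho> = "reduct \<psi> (compl m)"
  have "\<not> satisfies \<alpha> ?\<rho>" for \<alpha>
  proof
    assume sat: "satisfies \<alpha> ?\<rho>"
    \<comment> \<open>The all-true assignment satisfies exactly the positive literals, so this is
      the value that makes \<open>compl m\<close> true.\<close>
    define \<beta> where "\<beta> = \<alpha>(var_of m := sat_lit (\<lambda>_. True) (compl m))"
    have cm: "sat_lit \<beta> (compl m)" by (cases m) (auto simp: \<beta>_def)
    have other: "sat_lit \<beta> l \<longleftrightarrow> sat_lit \<alpha> l" if "l \<noteq> m" "l \<noteq> compl m" for l
      using that by (cases l; cases m) (auto simp: \<beta>_def)
    have "satisfies \<beta> \<psi>"
      unfolding satisfies_def
    proof
      fix C assume C: "C \<in> \<psi>"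
      show "\<exists>l\<in>C. sat_lit \<beta> l"
      proof (cases "compl m \<in> C")
        case False
        then have "C - {m} \<in> ?\<rho>" using C by (auto simp: reduct_def)
        then show ?thesis using sat other False by (fastforce simp: satisfies_def)
      qed (use cm in blast)
    qed
    then show False using \<psi>(4) cm by (auto simp: entails_def)
  qed
  moreover have "?\<rho> \<subseteq> reduct \<phi> (compl m)" using \<psi>(1) by (auto simp: reduct_def)
  moreover have "finite ?\<rho>" "card ?\<rho> \<le> k" using finite_reduct[OF \<psi>(2)] \<psi>(3) order_trans by blast+
  ultimately show ?thesis unfolding k_backbone_def entails_def by blast
qed

theorem iterative_k_backbone_krom_iff:
  assumes "\<phi> \<in> krom" "1 \<le> k"
  shows "iterative_k_backbone k \<phi> x \<longleftrightarrow> {} \<in> \<phi> \<or>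
    (\<exists>m. (\<exists>n\<le>k. (edge \<phi> ^^ n) (compl m) m) \<and>
      (contradictory \<phi> \<or> (\<exists>l. var_of l = x \<and> (edge \<phi>)\<^sup>*\<^sup>* m l)))"
    (is "_ \<longleftrightarrow> ?R \<phi>")
proof
  assume "iterative_k_backbone k \<phi> x"
  then show "?R \<phi>" using assms(1)
  proof (induction rule: iterative_k_backbone.induct)
    case (base \<phi> x)
    show ?case
    proof (cases "{} \<in> \<phi>")
      case False
      obtain m n where "n \<le> k" "(edge \<phi> ^^ n) (compl m) m"
        "satisfiable \<phi> \<Longrightarrow> \<exists>l. var_of l = x \<and> entails \<phi> {{l}} \<and> (edge \<phi>)\<^sup>*\<^sup>* m l"
        by (rule k_backbone_walk[OF base(2,1) False]) iprover
      then show ?thesis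
        using satisfiable_krom_iff[OF base(2) False] by blast
    qed blast
  next
    case (step y \<phi> l x)
    show ?case
    proof (cases "{} \<in> \<phi>")
      case ne: False
      obtain m n where m: "n \<le> k" "(edge \<phi> ^^ n) (compl m) m"
        "satisfiable \<phi> \<Longrightarrow> \<exists>l. var_of l = y \<and> entails \<phi> {{l}} \<and> (edge \<phi>)\<^sup>*\<^sup>* m l"
        by (rule k_backbone_walk[OF step.prems step.hyps(2) ne]) iprover
      show ?thesis
      proof (cases "satisfiable \<phi>")
        case False
        then show ?thesis using m ne satisfiable_krom_iff[OF step.prems] by blast
      next
        case True
        then obtain l' where l': "var_of l' = y" "entails \<phi> {{l'}}" "(edge \<phi>)\<^sup>*\<^sup>* m l'"
          using m by blast
        \<comment> \<open>Both are literals of \<open>y\<close> entailed by a satisfiable formula,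
          so they cannot be complementary.\<close>
        have "l' = l"
          using l' step.hyps(3,4) True unfolding satisfiable_def entails_def
          by (metis insertE sat_lit_compl satisfies_unit singletonD var_of.simps var_of_eq_iff)
        have "satisfiable (reduct \<phi> l)" using True step.hyps(4) satisfiable_reduct by blast
        then have "{} \<notin> reduct \<phi> l" "\<not> contradictory (reduct \<phi> l)"
          using not_satisfiable_empty_clause not_satisfiable_contradictory by blast+
        then obtain m1 n1 n2 l1 where 1: "n1 \<le> k" "(edge (reduct \<phi> l) ^^ n1) (compl m1) m1"
          "var_of l1 = x" "(edge (reduct \<phi> l) ^^ n2) m1 l1"
          using step.IH[OF krom_reduct[OF step.prems]] by (auto simp: rtranclp_power)
        \<comment> \<open>Each of the two walks in the reduct is either one in \<open>\<phi>\<close>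
          or has an end reachable from \<open>m\<close>; in the latter case \<open>m\<close> takes
          over the role of \<open>m1\<close>.\<close>
        note red = relpowp_reductD[OF step.prems l'(3)[unfolded \<open>l' = l\<close>]]
        show ?thesis
          using red[OF 1(2)] red[OF 1(4)] 1(1,3) m(1,2)
          by (metis relpowp_imp_rtranclp rtranclp_trans)
      qed
    qed blast
  qed
next
  assume R: "?R \<phi>"
  show "iterative_k_backbone k \<phi> x"
  proof (cases "{} \<in> \<phi>")
    case True
    then have "k_backbone k \<phi> x"
      unfolding k_backbone_def using assms(2)
      by (intro exI[of _ "{{}}"]) (auto simp: entails_def satisfies_def)
    then show ?thesis by (rule iterative_k_backbone.base)
  next
    case False
    then obtain m n where m: "n \<le> k" "(edge \<phi> ^^ n) (compl m) m"
      and *: "contradictory \<phi> \<or> (\<exists>l. var_of l = x \<and> (edge \<phi>)\<^sup>*\<^sup>* m l)"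
      using R by blast
    have ent: "k_entails k \<phi> m"
      using walk_entails[OF m(2)] m(1) unfolding k_entails_def by (metis order_trans)
    show ?thesis
    proof (cases "satisfiable \<phi>")
      case True
      then show ?thesis
        using * not_satisfiable_contradictory iterative_k_backbone_reach[OF assms(2) True ent]
        by (auto simp: rtranclp_power)
    next
      case unsat: False
      \<comment> \<open>A walk between the distinct literals \<open>compl m\<close> and
        \<open>m\<close> has a last edge, whose clause puts the variable of \<open>m\<close> into
        \<open>vars \<phi>\<close>, as the rule \<open>step\<close> demands.\<close>
      obtain n' where "n = Suc n'" using m(2) by (cases n) auto
      then obtain a where "edge \<phi> a m" using m(2) by auto
      then have "var_of m \<in> vars \<phi>" by (auto simp: edge_def vars_def)
      moreover have "iterative_k_backbone k (reduct \<phi> (compl m)) x"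
        using k_entails_reduct_compl[OF ent] by (rule iterative_k_backbone.base)
      moreover have "entails \<phi> {{compl m}}"
        using unsat by (auto simp: satisfiable_def entails_def)
      ultimately show ?thesis
        using k_entails_imp[OF ent]
        by (intro iterative_k_backbone.step[of "var_of m" \<phi> k "compl m"]) (cases m; auto)+
    qed
  qed
qed

section \<open>A loop language and its compilation to the machine\<close>

datatype arr = From | To | Dist | Co | Occ

datatype scal = Ans | Bad | Empty | Mode | Tgt | Sgn | Pow | Val | Top | Cnt
  | LA | LB | CA | CB | Lit | Col | NE | XV | KV | Sym | P | J | R | E | M | Src
  | D1 | Hit | Cyc | Near | Good | Unsat

datatype cell = S scal | A arr nat

datatype expr = Num nat | Var scal | Plus expr expr | Minus expr expr | Get arr expr | Inp expr

datatype com = Skip | Set scal expr | Put arr expr expr | Seq com com (infixr \<open>;;\<close> 60)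
  | If expr com com | For scal com

type_synonym state = "cell \<Rightarrow> nat"

primrec eval :: "bool list \<Rightarrow> state \<Rightarrow> expr \<Rightarrow> nat" where
  "eval w s (Num n) = n"
| "eval w s (Var x) = s (S x)"
| "eval w s (Plus e1 e2) = eval w s e1 + eval w s e2"
| "eval w s (Minus e1 e2) = eval w s e1 - eval w s e2"
| "eval w s (Get a e) = s (A a (eval w s e))"
| "eval w s (Inp e) = input_symbol w (eval w s e)"

text \<open>Every loop runs once for each position of the input, so that all programs terminate and
  take polynomial time.\<close>

primrec den :: "bool list \<Rightarrow> com \<Rightarrow> state \<Rightarrow> state" where
  "den w Skip s = s"
| "den w (Set x e) s = s(S x := eval w s e)"
| "den w (Put a i e) s = s(A a (eval w s i) := eval w s e)"
| "den w (c1 ;; c2) s = den w c2 (den w c1 s)"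
| "den w (If e c1 c2) s = (if eval w s e > 0 then den w c1 s else den w c2 s)"
| "den w (For x c) s = fold (\<lambda>i s. den w c (s(S x := i))) [0..<length w] s"

text \<open>Register \<open>8i + r\<close> holds a scalar (\<open>r = 0\<close>), a temporary value (\<open>r = 1\<close>), a loop counter
  (\<open>r = 2\<close>), or the \<open>i\<close>-th entry of an array (\<open>r \<ge> 3\<close>).\<close>

primrec idx :: "scal \<Rightarrow> nat" where
  "idx Ans = 0" | "idx Bad = 1" | "idx Empty = 2" | "idx Mode = 3" | "idx Tgt = 4" | "idx Sgn = 5"
| "idx Pow = 6" | "idx Val = 7" | "idx Top = 8" | "idx Cnt = 9" | "idx LA = 10" | "idx LB = 11"
| "idx CA = 12" | "idx CB = 13" | "idx Lit = 14" | "idx Col = 15" | "idx NE = 16" | "idx XV = 17"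
| "idx KV = 18" | "idx Sym = 19" | "idx P = 20" | "idx J = 21" | "idx R = 22" | "idx E = 23"
| "idx M = 24" | "idx Src = 25" | "idx D1 = 26" | "idx Hit = 27" | "idx Cyc = 28" | "idx Near = 29"
| "idx Good = 30" | "idx Unsat = 31"

primrec off :: "arr \<Rightarrow> nat" where
  "off From = 3" | "off To = 4" | "off Dist = 5" | "off Co = 6" | "off Occ = 7"

primrec addr :: "cell \<Rightarrow> nat" where
  "addr (S x) = 8 * idx x"
| "addr (A a i) = 8 * i + off a"

definition tmp :: "nat \<Rightarrow> nat" where "tmp t = 8 * t + 1"
definition ctr :: "nat \<Rightarrow> nat" where "ctr d = 8 * d + 2"

lemma off_bounds: "3 \<le> off a \<and> off a < 8"
  by (cases a) auto

lemma idx_eq_iff [simp]: "idx x = idx y \<longleftrightarrow> x = y"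
  by (cases x; cases y) simp_all

lemma off_eq_iff [simp]: "off a = off b \<longleftrightarrow> a = b"
  by (cases a; cases b) simp_all

lemma addr_eq_iff [simp]: "addr x = addr y \<longleftrightarrow> x = y"
proof
  assume eq: "addr x = addr y"
  show "x = y"
  proof (cases x; cases y)
    fix a b i j assume "x = A a i" "y = A b j"
    moreover from this have "i = j" using eq off_bounds[of a] off_bounds[of b] by simp
    ultimately show ?thesis using eq by simp
  next
    fix u a i assume "x = S u" "y = A a i"
    then show ?thesis using eq off_bounds[of a] by simp presburger
  next
    fix u a i assume "x = A a i" "y = S u"
    then show ?thesis using eq off_bounds[of a] by simp presburger
  qed (use eq in simp)
qed simp

lemma reg_neq [simp]:
  "addr x \<noteq> tmp t" "tmp t \<noteq> addr x" "addr x \<noteq> ctr d" "ctr d \<noteq> addr x" "tmp t \<noteq> ctr d" "ctr d \<noteq> tmp t"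
proof -
  have "addr x mod 8 = 0 \<or> 3 \<le> addr x mod 8"
    by (cases x) (use off_bounds in auto)
  moreover have "tmp t mod 8 = 1" "ctr d mod 8 = 2"
    by (simp_all add: tmp_def ctr_def mod_Suc)
  ultimately show "addr x \<noteq> tmp t" "tmp t \<noteq> addr x" "addr x \<noteq> ctr d" "ctr d \<noteq> addr x"
    "tmp t \<noteq> ctr d" "ctr d \<noteq> tmp t"
    by auto
qed

lemma tmp_ctr_inj [simp]: "tmp t = tmp u \<longleftrightarrow> t = u" "ctr d = ctr e \<longleftrightarrow> d = e"
  by (auto simp: tmp_def ctr_def)

section \<open>Compilation to machine code\<close>

abbreviation abs_state :: "(nat \<Rightarrow> nat) \<Rightarrow> state" where
  "abs_state X \<equiv> X \<circ> addr"

lemma abs_state_upd [simp]: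
  "abs_state (X(addr c := v)) = (abs_state X)(c := v)"
  "abs_state (X(tmp t := v)) = abs_state X"
  "abs_state (X(ctr d := v)) = abs_state X"
  by (auto simp: fun_eq_iff)

text \<open>The temporaries form a stack: the value ends up in \<open>tmp t\<close>, and those below
  \<open>t\<close> are kept. Copying is addition of 0, and the factor 8 of an array address is
  obtained by three doublings.\<close>

primrec cexp :: "expr \<Rightarrow> nat \<Rightarrow> instr list" where
  "cexp (Num n) t = [Const (tmp t) n]"
| "cexp (Var x) t = [Const (tmp t) 0, Add (tmp t) (addr (S x)) (tmp t)]"
| "cexp (Plus e1 e2) t = cexp e1 t @ cexp e2 (Suc t) @ [Add (tmp t) (tmp t) (tmp (Suc t))]"
| "cexp (Minus e1 e2) t = cexp e1 t @ cexp e2 (Suc t) @ [Sub (tmp t) (tmp t) (tmp (Suc t))]"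
| "cexp (Get a e) t = cexp e t @
     [Add (tmp t) (tmp t) (tmp t), Add (tmp t) (tmp t) (tmp t), Add (tmp t) (tmp t) (tmp t),
      Const (tmp (Suc t)) (off a), Add (tmp t) (tmp t) (tmp (Suc t)), Load (tmp t) (tmp t)]"
| "cexp (Inp e) t = cexp e t @ [Input (tmp t) (tmp t)]"

text \<open>Jump targets are absolute, so \<open>emit\<close> must know the length of code before
  producing it; the length depends neither on nesting depth nor on position.\<close>

primrec size_com :: "com \<Rightarrow> nat" where
  "size_com Skip = 0"
| "size_com (Set x e) = length (cexp e 0) + 2"
| "size_com (Put a i e) = length (cexp i 0) + length (cexp e 1) + 6"
| "size_com (c1 ;; c2) = size_com c1 + size_com c2"
| "size_com (If e c1 c2) = length (cexp e 0) + size_com c2 + size_com c1 + 3"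
| "size_com (For x c) = size_com c + 10"

text \<open>The parameters of \<open>emit\<close> are the loop nesting depth and the address of the first instruction.\<close>

primrec emit :: "nat \<Rightarrow> nat \<Rightarrow> com \<Rightarrow> instr list" where
  "emit d a Skip = []"
| "emit d a (Set x e) = cexp e 0 @ [Const (tmp 1) 0, Add (addr (S x)) (tmp 0) (tmp 1)]"
| "emit d a (Put r i e) = cexp i 0 @ cexp e 1 @
     [Add (tmp 0) (tmp 0) (tmp 0), Add (tmp 0) (tmp 0) (tmp 0), Add (tmp 0) (tmp 0) (tmp 0),
      Const (tmp 2) (off r), Add (tmp 0) (tmp 0) (tmp 2), Store (tmp 0) (tmp 1)]"
| "emit d a (c1 ;; c2) = emit d a c1 @ emit d (a + size_com c1) c2"
| "emit d a (If e c1 c2) = cexp e 0 @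
     [Jump (tmp 0) (a + length (cexp e 0) + size_com c2 + 3)] @
     emit d (a + length (cexp e 0) + 1) c2 @
     [Const (tmp 0) 1, Jump (tmp 0) (a + length (cexp e 0) + size_com c2 + size_com c1 + 3)] @
     emit d (a + length (cexp e 0) + size_com c2 + 3) c1"
| "emit d a (For x c) =
     [Const (ctr d) 0, Input (tmp 0) (ctr d), Jump (tmp 0) (a + 5), Const (tmp 0) 1,
      Jump (tmp 0) (a + size_com c + 10), Const (tmp 1) 0, Add (addr (S x)) (ctr d) (tmp 1)] @
     emit (Suc d) (a + 7) c @
     [Const (tmp 0) 1, Add (ctr d) (ctr d) (tmp 0), Jump (tmp 0) (a + 1)]"

text \<open>\<open>[:0, 1:]\<close> is the indeterminate, standing for the input length. A loop
  spends 1 step on clearing its counter, 4 on the final test and exit, and 7 per round besides the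
  body. A conditional is charged for both branches, 1 for its jump and 2 for leaving the else
  branch.\<close>

primrec cost :: "com \<Rightarrow> nat poly" where
  "cost Skip = 0"
| "cost (Set x e) = [:length (cexp e 0) + 2:]"
| "cost (Put a i e) = [:length (cexp i 0) + length (cexp e 1) + 6:]"
| "cost (c1 ;; c2) = cost c1 + cost c2"
| "cost (If e c1 c2) = [:length (cexp e 0) + 3:] + cost c1 + cost c2"
| "cost (For x c) = [:5:] + [:0, 1:] * ([:7:] + cost c)"

lemma length_emit [simp]: "length (emit d a c) = size_com c"
  by (induction c arbitrary: d a) auto

section \<open>Simulation of the loop language by the machine\<close>

primrec code_at :: "instr list \<Rightarrow> nat \<Rightarrow> instr list \<Rightarrow> bool" where
  "code_at Q a [] \<longleftrightarrow> True"
| "code_at Q a (i # is) \<longleftrightarrow> a < length Q \<and> Q ! a = i \<and> code_at Q (Suc a) is"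

lemma code_at_append [simp]:
  "code_at Q a (xs @ ys) \<longleftrightarrow> code_at Q a xs \<and> code_at Q (a + length xs) ys"
  by (induction xs arbitrary: a) auto

lemma code_at_self: "code_at (xs @ ys) (length xs) ys"
proof (induction ys arbitrary: xs)
  case (Cons y ys)
  show ?case using Cons[of "xs @ [y]"] by (simp add: nth_append)
qed simp

definition runs :: "instr list \<Rightarrow> bool list \<Rightarrow> nat \<Rightarrow> config \<Rightarrow> config \<Rightarrow> bool" where
  "runs Q w n c c' \<longleftrightarrow> (\<exists>m\<le>n. (ram_step Q w ^^ m) c = c')"

lemma runs_refl [simp]: "runs Q w n c c"
  by (auto simp: runs_def intro: exI[of _ 0])

lemma runs_trans: "runs Q w m a b \<Longrightarrow> runs Q w n b c \<Longrightarrow> m + n \<le> k \<Longrightarrow> runs Q w k a c"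
  unfolding runs_def
proof (elim exE conjE)
  fix i j assume "i \<le> m" "(ram_step Q w ^^ i) a = b" "j \<le> n" "(ram_step Q w ^^ j) b = c" "m + n \<le> k"
  then show "\<exists>l\<le>k. (ram_step Q w ^^ l) a = c"
    by (intro exI[of _ "j + i"]) (auto simp: funpow_add)
qed

lemma runs_step: "a < length Q \<Longrightarrow> runs Q w n (exec w (Q ! a) (a, X)) c \<Longrightarrow> runs Q w (Suc n) (a, X) c"
  unfolding runs_def
proof (elim exE conjE)
  fix i assume "a < length Q" "i \<le> n" "(ram_step Q w ^^ i) (exec w (Q ! a) (a, X)) = c"
  then show "\<exists>l\<le>Suc n. (ram_step Q w ^^ l) (a, X) = c"
    by (intro exI[of _ "Suc i"]) (auto simp: funpow_Suc_right ram_step_def halted_def simp del: funpow.simps)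
qed

text \<open>Delimits what evaluating an expression into \<open>tmp t\<close> may disturb.\<close>

definition agree :: "nat \<Rightarrow> (nat \<Rightarrow> nat) \<Rightarrow> (nat \<Rightarrow> nat) \<Rightarrow> bool" where
  "agree t X Y \<longleftrightarrow> (\<forall>r. (\<forall>u\<ge>t. r \<noteq> tmp u) \<longrightarrow> X r = Y r)"

lemma agree_abs: "agree t X Y \<Longrightarrow> abs_state Y = abs_state X"
  by (auto simp: agree_def fun_eq_iff)

lemma agree_tmp: "agree t X Y \<Longrightarrow> u < t \<Longrightarrow> Y (tmp u) = X (tmp u)"
  by (auto simp: agree_def)

lemma agree_ctr: "agree t X Y \<Longrightarrow> Y (ctr u) = X (ctr u)"
  by (auto simp: agree_def)

lemma agree_upd: "agree t X Y \<Longrightarrow> t \<le> u \<Longrightarrow> agree t X (Y(tmp u := v))"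
  by (auto simp: agree_def)

lemma agree_refl [simp]: "agree t X X"
  by (auto simp: agree_def)

lemma agree_trans: "agree t X Y \<Longrightarrow> agree u Y Z \<Longrightarrow> t \<le> u \<Longrightarrow> agree t X Z"
  by (auto simp: agree_def)

lemma addr_A: "off r + (a + a + (a + a) + (a + a + (a + a))) = addr (A r a)"
  "(a + a + (a + a) + (a + a + (a + a))) + off r = addr (A r a)"
  by simp_all

lemma runs_cexp:
  "code_at Q a (cexp e t) \<Longrightarrow> \<exists>Y. runs Q w (length (cexp e t)) (a, X) (a + length (cexp e t), Y) \<and>
     Y (tmp t) = eval w (abs_state X) e \<and> agree t X Y"
proof (induction e arbitrary: t a X)
  case (Num n)
  have "runs Q w (length (cexp (Num n) t)) (a, X) (a + length (cexp (Num n) t), X(tmp t := n))"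
    using Num by (auto intro!: runs_step)
  moreover have "agree t X (X(tmp t := n))" by (simp add: agree_upd)
  ultimately show ?case by (metis eval.simps(1) fun_upd_same)
next
  case (Var x)
  let ?Y = "X(tmp t := X (addr (S x)))"
  have "runs Q w (length (cexp (Var x) t)) (a, X) (a + length (cexp (Var x) t), ?Y)"
    using Var by (auto intro!: runs_step simp del: addr.simps)
  moreover have "agree t X ?Y" by (simp add: agree_upd)
  moreover have "?Y (tmp t) = eval w (abs_state X) (Var x)" by simp
  ultimately show ?case by blast
next
  case (Plus e1 e2)
  let ?l1 = "length (cexp e1 t)" and ?l2 = "length (cexp e2 (Suc t))"
  obtain Y where Y: "runs Q w ?l1 (a, X) (a + ?l1, Y)"
      "Y (tmp t) = eval w (abs_state X) e1" "agree t X Y"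
    using Plus.IH(1)[of a t X] Plus.prems[unfolded cexp.simps code_at_append] by blast
  obtain Z where Z: "runs Q w ?l2 (a + ?l1, Y) (a + ?l1 + ?l2, Z)"
      "Z (tmp (Suc t)) = eval w (abs_state Y) e2" "agree (Suc t) Y Z"
    using Plus.IH(2)[of "a + ?l1" "Suc t" Y] Plus.prems[unfolded cexp.simps code_at_append] by blast
  let ?Z = "Z(tmp t := Z (tmp t) + Z (tmp (Suc t)))"
  have st: "runs Q w (Suc 0) (a + ?l1 + ?l2, Z) (Suc (a + ?l1 + ?l2), ?Z)"
    using Plus.prems by (intro runs_step) auto
  have "runs Q w (length (cexp (Plus e1 e2) t)) (a, X) (a + length (cexp (Plus e1 e2) t), ?Z)"
    using runs_trans[OF Y(1) runs_trans[OF Z(1) st order_refl] order_refl] by (simp add: add.assoc eval_nat_numeral)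
  moreover have "agree t X ?Z" using agree_trans[OF Y(3) Z(3)] by (auto intro: agree_upd)
  moreover have "?Z (tmp t) = eval w (abs_state X) (Plus e1 e2)"
    using Y Z agree_abs[OF Y(3)] agree_tmp[OF Z(3), of t] by simp
  ultimately show ?case by blast
next
  case (Minus e1 e2)
  let ?l1 = "length (cexp e1 t)" and ?l2 = "length (cexp e2 (Suc t))"
  obtain Y where Y: "runs Q w ?l1 (a, X) (a + ?l1, Y)"
      "Y (tmp t) = eval w (abs_state X) e1" "agree t X Y"
    using Minus.IH(1)[of a t X] Minus.prems[unfolded cexp.simps code_at_append] by blast
  obtain Z where Z: "runs Q w ?l2 (a + ?l1, Y) (a + ?l1 + ?l2, Z)"
      "Z (tmp (Suc t)) = eval w (abs_state Y) e2" "agree (Suc t) Y Z"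
    using Minus.IH(2)[of "a + ?l1" "Suc t" Y] Minus.prems[unfolded cexp.simps code_at_append] by blast
  let ?Z = "Z(tmp t := Z (tmp t) - Z (tmp (Suc t)))"
  have st: "runs Q w (Suc 0) (a + ?l1 + ?l2, Z) (Suc (a + ?l1 + ?l2), ?Z)"
    using Minus.prems by (intro runs_step) auto
  have "runs Q w (length (cexp (Minus e1 e2) t)) (a, X) (a + length (cexp (Minus e1 e2) t), ?Z)"
    using runs_trans[OF Y(1) runs_trans[OF Z(1) st order_refl] order_refl] by (simp add: add.assoc eval_nat_numeral)
  moreover have "agree t X ?Z" using agree_trans[OF Y(3) Z(3)] by (auto intro: agree_upd)
  moreover have "?Z (tmp t) = eval w (abs_state X) (Minus e1 e2)"
    using Y Z agree_abs[OF Y(3)] agree_tmp[OF Z(3), of t] by simp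
  ultimately show ?case by blast
next
  case (Get r e)
  let ?l = "length (cexp e t)"
  obtain Y where Y: "runs Q w ?l (a, X) (a + ?l, Y)"
      "Y (tmp t) = eval w (abs_state X) e" "agree t X Y"
    using Get.IH[of a t X] Get.prems[unfolded cexp.simps code_at_append] by blast
  let ?Z = "Y(tmp (Suc t) := off r, tmp t := Y (addr (A r (Y (tmp t)))))"
  have st: "runs Q w 6 (a + ?l, Y) (a + ?l + 6, ?Z)"
    using Get.prems unfolding numeral_eq_Suc pred_numeral_simps BitM.simps
    by (auto intro!: runs_step simp: addr_A fun_upd_twist simp del: addr.simps)
  have "runs Q w (length (cexp (Get r e) t)) (a, X) (a + length (cexp (Get r e) t), ?Z)"
    using runs_trans[OF Y(1) st order_refl] by (simp add: add.assoc eval_nat_numeral del: addr.simps)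
  moreover have "agree t X ?Z" using Y(3) by (simp add: agree_upd del: addr.simps)
  moreover have "?Z (tmp t) = eval w (abs_state X) (Get r e)"
    using Y agree_abs[OF Y(3)] by (metis comp_apply eval.simps(5) fun_upd_same)
  ultimately show ?case by blast
next
  case (Inp e)
  let ?l = "length (cexp e t)"
  obtain Y where Y: "runs Q w ?l (a, X) (a + ?l, Y)"
      "Y (tmp t) = eval w (abs_state X) e" "agree t X Y"
    using Inp.IH[of a t X] Inp.prems[unfolded cexp.simps code_at_append] by blast
  let ?Z = "Y(tmp t := input_symbol w (Y (tmp t)))"
  have st: "runs Q w (Suc 0) (a + ?l, Y) (Suc (a + ?l), ?Z)"
    using Inp.prems by (intro runs_step) auto
  have "runs Q w (length (cexp (Inp e) t)) (a, X) (a + length (cexp (Inp e) t), ?Z)"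
    using runs_trans[OF Y(1) st order_refl] by (simp add: add.assoc eval_nat_numeral)
  moreover have "agree t X ?Z" using Y(3) by (simp add: agree_upd del: addr.simps)
  moreover have "?Z (tmp t) = eval w (abs_state X) (Inp e)" using Y(2) by simp
  ultimately show ?case by blast
qed

text \<open>The counters of enclosing loops must be part of the induction. They are kept apart from
  the loop variables, so a body may even assign its own loop variable without changing the number of
  rounds.\<close>

lemma runs_emit:
  "code_at Q a (emit d a c) \<Longrightarrow> \<exists>Y. runs Q w (poly (cost c) (length w)) (a, X) (a + size_com c, Y) \<and>
     abs_state Y = den w c (abs_state X) \<and> (\<forall>u<d. Y (ctr u) = X (ctr u))"
proof (induction c arbitrary: d a X)
  case Skip
  show ?case by (auto intro!: exI[of _ X])
next
  case (Set x e)
  let ?l = "length (cexp e 0)"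
  obtain Y where Y: "runs Q w ?l (a, X) (a + ?l, Y)"
      "Y (tmp 0) = eval w (abs_state X) e" "agree 0 X Y"
    using runs_cexp[of Q a e 0 w X] Set.prems[unfolded emit.simps code_at_append length_emit] by blast
  let ?Z = "Y(tmp 1 := 0, addr (S x) := Y (tmp 0))"
  have st: "runs Q w 2 (a + ?l, Y) (a + ?l + 2, ?Z)"
    using Set.prems unfolding numeral_eq_Suc pred_numeral_simps
    by (auto intro!: runs_step simp: fun_upd_twist simp del: addr.simps)
  have "runs Q w (poly (cost (Set x e)) (length w)) (a, X) (a + size_com (Set x e), ?Z)"
    using runs_trans[OF Y(1) st order_refl] by (simp add: add.assoc eval_nat_numeral)
  moreover have "abs_state ?Z = den w (Set x e) (abs_state X)"
    using Y(2) agree_abs[OF Y(3)] agree_ctr[OF Y(3)] by (simp del: addr.simps)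
  moreover have "\<forall>u<d. ?Z (ctr u) = X (ctr u)"
    using Y(2) agree_abs[OF Y(3)] agree_ctr[OF Y(3)] by (simp del: addr.simps)
  ultimately show ?case by blast
next
  case (Put r i e)
  let ?l = "length (cexp i 0)" and ?m = "length (cexp e 1)"
  obtain Y where Y: "runs Q w ?l (a, X) (a + ?l, Y)"
      "Y (tmp 0) = eval w (abs_state X) i" "agree 0 X Y"
    using runs_cexp[of Q a i 0 w X] Put.prems[unfolded emit.simps code_at_append length_emit] by blast
  obtain Z where Z: "runs Q w ?m (a + ?l, Y) (a + ?l + ?m, Z)"
      "Z (tmp 1) = eval w (abs_state Y) e" "agree 1 Y Z"
    using runs_cexp[of Q "a + ?l" e 1 w Y] Put.prems[unfolded emit.simps code_at_append length_emit] by blast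
  let ?ad = "addr (A r (Z (tmp 0)))"
  let ?Z = "Z(tmp 2 := off r, tmp 0 := ?ad, ?ad := Z (tmp 1))"
  have st: "runs Q w 6 (a + ?l + ?m, Z) (a + ?l + ?m + 6, ?Z)"
    using Put.prems unfolding numeral_eq_Suc pred_numeral_simps BitM.simps
    by (auto intro!: runs_step simp: addr_A fun_upd_twist eval_nat_numeral simp del: addr.simps)
  have "runs Q w (poly (cost (Put r i e)) (length w)) (a, X) (a + size_com (Put r i e), ?Z)"
    using runs_trans[OF Y(1) runs_trans[OF Z(1) st order_refl] order_refl] by (simp add: add.assoc eval_nat_numeral)
  moreover have "abs_state ?Z = den w (Put r i e) (abs_state X)"
    using Y(2) Z(2) agree_abs[OF Y(3)] agree_abs[OF Z(3)] agree_ctr[OF Y(3)] agree_ctr[OF Z(3)]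
      agree_tmp[OF Z(3), of 0] by (simp del: addr.simps)
  moreover have "\<forall>u<d. ?Z (ctr u) = X (ctr u)"
    using Y(2) Z(2) agree_abs[OF Y(3)] agree_abs[OF Z(3)] agree_ctr[OF Y(3)] agree_ctr[OF Z(3)]
      agree_tmp[OF Z(3), of 0] by (simp del: addr.simps)
  ultimately show ?case by blast
next
  case (Seq c1 c2)
  obtain Y where Y: "runs Q w (poly (cost c1) (length w)) (a, X) (a + size_com c1, Y)"
      "abs_state Y = den w c1 (abs_state X)" "\<forall>u<d. Y (ctr u) = X (ctr u)"
    using Seq.IH(1)[of a d X] Seq.prems[unfolded emit.simps code_at_append length_emit] by blast
  obtain Z where Z: "runs Q w (poly (cost c2) (length w)) (a + size_com c1, Y) (a + size_com c1 + size_com c2, Z)"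
      "abs_state Z = den w c2 (abs_state Y)" "\<forall>u<d. Z (ctr u) = Y (ctr u)"
    using Seq.IH(2)[of "a + size_com c1" d Y] Seq.prems[unfolded emit.simps code_at_append length_emit] by blast
  have "runs Q w (poly (cost (c1 ;; c2)) (length w)) (a, X) (a + size_com (c1 ;; c2), Z)"
    using runs_trans[OF Y(1) Z(1) order_refl] by (simp add: add.assoc)
  moreover have "abs_state Z = den w (c1 ;; c2) (abs_state X)"
    using Y(2,3) Z(2,3) by (simp del: addr.simps)
  moreover have "\<forall>u<d. Z (ctr u) = X (ctr u)"
    using Y(2,3) Z(2,3) by (simp del: addr.simps)
  ultimately show ?case by blast
next
  case (If e c1 c2)
  let ?l = "length (cexp e 0)" and ?end = "a + size_com (If e c1 c2)"
  let ?a2 = "a + ?l + 1" and ?a1 = "a + ?l + size_com c2 + 3"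
  obtain Y where Y: "runs Q w ?l (a, X) (a + ?l, Y)"
      "Y (tmp 0) = eval w (abs_state X) e" "agree 0 X Y"
    using runs_cexp[of Q a e 0 w X] If.prems[unfolded emit.simps code_at_append]
      by (simp add: eval_nat_numeral add_ac del: addr.simps cexp.simps fun_upd_apply comp_apply) blast
  have jump: "runs Q w 1 (a + ?l, Y) (if Y (tmp 0) > 0 then ?a1 else ?a2, Y)"
    using If.prems runs_step[of "a + ?l" Q w 0 Y] by auto
  show ?case
  proof (cases "Y (tmp 0) > 0")
    case True
    obtain Z where Z: "runs Q w (poly (cost c1) (length w)) (?a1, Y) (?a1 + size_com c1, Z)"
        "abs_state Z = den w c1 (abs_state Y)" "\<forall>u<d. Z (ctr u) = Y (ctr u)"
      using If.IH(1)[of ?a1 d Y] If.prems[unfolded emit.simps code_at_append]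
      by (simp add: eval_nat_numeral add_ac del: addr.simps cexp.simps fun_upd_apply comp_apply) blast
    have "runs Q w (poly (cost (If e c1 c2)) (length w)) (a, X) (?a1 + size_com c1, Z)"
      using True by (intro runs_trans[OF Y(1) runs_trans[OF jump _ order_refl]]) (use Z(1) in auto)
    then have "runs Q w (poly (cost (If e c1 c2)) (length w)) (a, X) (?end, Z)"
      by (simp add: ac_simps)
    moreover have "abs_state Z = den w (If e c1 c2) (abs_state X)"
    using Y(2) Z(2,3) True agree_abs[OF Y(3)] agree_ctr[OF Y(3)] by (simp del: addr.simps)
  moreover have "\<forall>u<d. Z (ctr u) = X (ctr u)"
    using Y(2) Z(2,3) True agree_abs[OF Y(3)] agree_ctr[OF Y(3)] by (simp del: addr.simps)
  ultimately show ?thesis by blast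
  next
    case False
    obtain Z where Z: "runs Q w (poly (cost c2) (length w)) (?a2, Y) (?a2 + size_com c2, Z)"
        "abs_state Z = den w c2 (abs_state Y)" "\<forall>u<d. Z (ctr u) = Y (ctr u)"
      using If.IH(2)[of ?a2 d Y] If.prems[unfolded emit.simps code_at_append]
      by (simp add: eval_nat_numeral add_ac del: addr.simps cexp.simps fun_upd_apply comp_apply) blast
    have "runs Q w 2 (?a2 + size_com c2, Z) (?end, Z(tmp 0 := 1))"
      using If.prems unfolding numeral_eq_Suc pred_numeral_simps
      by (auto intro!: runs_step simp: add_ac)
    then have "runs Q w (poly (cost (If e c1 c2)) (length w)) (a, X) (?end, Z(tmp 0 := 1))"
      using False
      by (intro runs_trans[OF Y(1) runs_trans[OF jump runs_trans[OF _ _ order_refl] order_refl]])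
        (use Z(1) in auto)
    moreover have "abs_state (Z(tmp 0 := 1)) = den w (If e c1 c2) (abs_state X)"
    using Y(2) Z(2,3) False agree_abs[OF Y(3)] agree_ctr[OF Y(3)] by (simp del: addr.simps)
  moreover have "\<forall>u<d. (Z(tmp 0 := 1)) (ctr u) = X (ctr u)"
    using Y(2) Z(2,3) False agree_abs[OF Y(3)] agree_ctr[OF Y(3)] by (simp del: addr.simps)
  ultimately show ?thesis by blast
  qed
next
  case (For x c)
  let ?T = "poly (cost c) (length w)" and ?N = "length w"
  let ?end = "a + size_com (For x c)" and ?f = "\<lambda>i s. den w c (s(S x := i))"
  note code = For.prems[unfolded emit.simps code_at_append length_emit]
  have code_body: "code_at Q (a + 7) (emit (Suc d) (a + 7) c)"
    using code by (simp add: eval_nat_numeral)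
  \<comment> \<open>Induction on the number \<open>j\<close> of remaining rounds. The loop test
    reads the input at the counter; the symbol is 0 only beyond the end of the word.\<close>
  have loop: "\<exists>Z. runs Q w (j * (7 + ?T) + 4) (a + 1, Y) (?end, Z) \<and>
      abs_state Z = fold ?f [?N - j..<?N] (abs_state Y) \<and> (\<forall>u<d. Z (ctr u) = Y (ctr u))"
    if "Y (ctr d) = ?N - j" "j \<le> ?N" for j Y
    using that
  proof (induction j arbitrary: Y)
    case 0
    let ?Z = "Y(tmp 0 := 1)"
    have "runs Q w 4 (a + 1, Y) (?end, ?Z)"
      using code 0 unfolding numeral_eq_Suc pred_numeral_simps BitM.simps
      by (auto intro!: runs_step simp: input_symbol_def eval_nat_numeral simp del: addr.simps)
    moreover have "abs_state ?Z = fold ?f [?N - 0..<?N] (abs_state Y)" by simp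
    moreover have "\<forall>u<d. ?Z (ctr u) = Y (ctr u)" by simp
    ultimately show ?case unfolding mult_0 add_0 by blast
  next
    case (Suc j)
    let ?i = "?N - Suc j"
    let ?Y = "Y(tmp 0 := input_symbol w ?i, tmp 1 := 0, addr (S x) := ?i)"
    have start: "runs Q w 4 (a + 1, Y) (a + 7, ?Y)"
      using code Suc.prems unfolding numeral_eq_Suc pred_numeral_simps BitM.simps
      by (auto intro!: runs_step simp: input_symbol_def eval_nat_numeral simp del: addr.simps)
    obtain Z where Z: "runs Q w ?T (a + 7, ?Y) (a + 7 + size_com c, Z)"
        "abs_state Z = den w c (abs_state ?Y)" "\<forall>u<Suc d. Z (ctr u) = ?Y (ctr u)"
      using For.IH[OF code_body, of ?Y] by blast
    let ?Z = "Z(tmp 0 := 1, ctr d := Suc ?i)"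
    have again: "runs Q w 3 (a + 7 + size_com c, Z) (a + 1, ?Z)"
      using code Z(3) Suc.prems unfolding numeral_eq_Suc pred_numeral_simps BitM.simps
      by (auto intro!: runs_step simp: eval_nat_numeral simp del: addr.simps)
    have body: "runs Q w (7 + ?T) (a + 1, Y) (a + 1, ?Z)"
      by (rule runs_trans[OF start runs_trans[OF Z(1) again order_refl]]) simp
    have counter: "?Z (ctr d) = ?N - j" and le: "j \<le> ?N" using Suc.prems by simp_all
    obtain V where V: "runs Q w (j * (7 + ?T) + 4) (a + 1, ?Z) (?end, V)"
        "abs_state V = fold ?f [?N - j..<?N] (abs_state ?Z)" "\<forall>u<d. V (ctr u) = ?Z (ctr u)"
      using Suc.IH[of ?Z, OF counter le] by blast
    have run: "runs Q w (Suc j * (7 + ?T) + 4) (a + 1, Y) (?end, V)"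
      by (rule runs_trans[OF body V(1)]) simp
    moreover have "[?i..<?N] = ?i # [?N - j..<?N]"
      using Suc.prems by (simp add: upt_conv_Cons Suc_diff_Suc)
    ultimately have "abs_state V = fold ?f [?N - Suc j..<?N] (abs_state Y)"
      using V(2) Z(2) by (simp del: addr.simps)
    moreover have "\<forall>u<d. V (ctr u) = Y (ctr u)"
      using V(3) Z(3) by (simp del: addr.simps)
    ultimately show ?case using run by blast
  qed
  let ?X = "X(ctr d := 0)"
  have counter: "?X (ctr d) = ?N - ?N" by simp
  obtain Z where Z: "runs Q w (?N * (7 + ?T) + 4) (a + 1, ?X) (?end, Z)"
      "abs_state Z = fold ?f [?N - ?N..<?N] (abs_state ?X)" "\<forall>u<d. Z (ctr u) = ?X (ctr u)"
    using loop[of ?X ?N, OF counter order_refl] by blast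
  have "runs Q w 1 (a, X) (a + 1, ?X)"
    using code runs_step[of a Q w 0 X] by auto
  then have "runs Q w (poly (cost (For x c)) (length w)) (a, X) (?end, Z)"
    by (rule runs_trans[OF _ Z(1)]) (simp add: algebra_simps)
  moreover have "abs_state Z = den w (For x c) (abs_state X)"
    using Z(2,3) by (simp del: addr.simps)
  moreover have "\<forall>u<d. Z (ctr u) = X (ctr u)"
    using Z(2,3) by (simp del: addr.simps)
  ultimately show ?case by blast
qed

text \<open>\<open>Ans\<close> is held in register 0, where the answer is read, and compiled code
  halts by running past its last instruction.\<close>

theorem den_polynomial_time:
  assumes "\<And>w. den w c (\<lambda>_. 0) (S Ans) > 0 \<longleftrightarrow> w \<in> L"
  shows "L \<in> polynomial_time"
proof -
  let ?Q = "emit 0 0 c"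
  have "decides_in_time ?Q L (poly (cost c))"
    unfolding decides_in_time_def
  proof
    fix w
    obtain Y where Y: "runs ?Q w (poly (cost c) (length w)) (0, \<lambda>_. 0) (size_com c, Y)"
        "abs_state Y = den w c (abs_state (\<lambda>_. 0))"
      using runs_emit[of ?Q 0 0 c w "\<lambda>_. 0"] code_at_self[of "[]" ?Q] by auto
    then obtain m where m: "m \<le> poly (cost c) (length w)"
        "(ram_step ?Q w ^^ m) (0, \<lambda>_. 0) = (size_com c, Y)"
      by (auto simp: runs_def)
    have fixpoint: "(ram_step ?Q w ^^ n) (size_com c, Y) = (size_com c, Y)" for n
      by (induction n) (auto simp: ram_step_def halted_def)
    have "poly (cost c) (length w) = (poly (cost c) (length w) - m) + m" using m by simp
    then have "run ?Q w (poly (cost c) (length w)) =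
        (ram_step ?Q w ^^ (poly (cost c) (length w) - m)) ((ram_step ?Q w ^^ m) (0, \<lambda>_. 0))"
      unfolding run_def using funpow_add[of _ m] by (metis comp_apply)
    then have "run ?Q w (poly (cost c) (length w)) = (size_com c, Y)"
      using m(2) fixpoint by simp
    moreover have "Y 0 = den w c (\<lambda>_. 0) (S Ans)"
      using fun_cong[OF Y(2), of "S Ans"] by (simp add: o_def)
    ultimately show "halted ?Q (run ?Q w (poly (cost c) (length w))) \<and>
        (snd (run ?Q w (poly (cost c) (length w))) 0 > 0 \<longleftrightarrow> w \<in> L)"
      using assms by (simp add: halted_def)
  qed
  then show ?thesis unfolding polynomial_time_def by blast
qed

section \<open>Parsing an instance\<close>

abbreviation items :: "('a \<Rightarrow> bool list) \<Rightarrow> 'a list \<Rightarrow> bool list" where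
  "items f xs \<equiv> concat (map (\<lambda>x. True # f x) xs)"

abbreviation enc_clause :: "nat lit list \<Rightarrow> bool list" where
  "enc_clause \<equiv> enc_list enc_lit"

section \<open>Binary numerals\<close>

fun number :: "bool list \<Rightarrow> nat" where
  "number [] = 0"
| "number (b # bs) = of_bool b + 2 * number bs"

text \<open>Bits come least significant first, so absence of leading zeros concerns the last bit;
  the empty string denotes 0.\<close>

definition canonical :: "bool list \<Rightarrow> bool" where
  "canonical bs \<longleftrightarrow> bs = [] \<or> last bs"

lemma number_append: "number (bs @ [b]) = number bs + 2 ^ length bs * of_bool b"
  by (induction bs) (auto simp: algebra_simps)

lemma number_bits_of [simp]: "number (bits_of n) = n"
  by (induction n rule: bits_of.induct) (subst bits_of.simps, auto simp: odd_iff_mod_2_eq_one)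

lemma bits_of_eq_Nil [simp]: "bits_of n = [] \<longleftrightarrow> n = 0"
  by (subst bits_of.simps) simp

lemma canonical_bits_of [simp]: "canonical (bits_of n)"
proof (induction n rule: bits_of.induct)
  case (1 n)
  show ?case
  proof (cases "n = 0")
    case False
    then have "canonical (bits_of (n div 2))" using 1 by simp
    moreover have "n div 2 = 0 \<Longrightarrow> odd n" using False by presburger
    ultimately show ?thesis
      using False by (subst bits_of.simps) (auto simp: canonical_def)
  qed (simp add: canonical_def)
qed

lemma bits_of_number: "canonical bs \<Longrightarrow> bits_of (number bs) = bs"
proof (induction bs)
  case (Cons b bs)
  then have can: "canonical bs" and b: "bs = [] \<Longrightarrow> b"
    by (auto simp: canonical_def split: if_splits)
  have "number (b # bs) \<noteq> 0"
  proof (cases "bs = []")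
    case False
    then have "number bs \<noteq> 0" using Cons.IH[OF can] by (metis bits_of_eq_Nil)
    then show ?thesis by simp
  qed (use b in simp)
  then show ?case using Cons.IH[OF can] by (subst bits_of.simps) auto
qed (simp add: bits_of.simps)

section \<open>A one-pass parser for the encoding\<close>

datatype target = TLit "nat lit list list" "nat lit list" bool | TX "nat lit list list"
  | TK "nat lit list list" nat

text \<open>Each state carries everything read so far, so the consumed prefix can be recovered from
  it. \<open>Bits\<close> expects the flag that announces a further bit or ends the number,
  \<open>Bit\<close> the bit itself; the target tells what the number is for.\<close>

datatype pstate = Clauses "nat lit list list" | InClause "nat lit list list" "nat lit list"
  | Sign "nat lit list list" "nat lit list" | Bits target "bool list" | Bit target "bool list"
  | Done "nat lit list list" nat nat | Fail

definition mk_lit :: "bool \<Rightarrow> nat \<Rightarrow> nat lit" where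
  "mk_lit b n = (if b then Pos n else Neg n)"

primrec finish :: "target \<Rightarrow> nat \<Rightarrow> pstate" where
  "finish (TLit cs ls b) n = InClause cs (ls @ [mk_lit b n])"
| "finish (TX cs) n = Bits (TK cs n) []"
| "finish (TK cs x) n = Done cs x n"

primrec pstep :: "pstate \<Rightarrow> bool \<Rightarrow> pstate" where
  "pstep (Clauses cs) b = (if b then InClause cs [] else Bits (TX cs) [])"
| "pstep (InClause cs ls) b = (if b then Sign cs ls else Clauses (cs @ [ls]))"
| "pstep (Sign cs ls) b = Bits (TLit cs ls b) []"
| "pstep (Bits t bs) b =
    (if b then Bit t bs else if canonical bs then finish t (number bs) else Fail)"
| "pstep (Bit t bs) b = Bits t (bs @ [b])"
| "pstep (Done cs x k) b = Fail"
| "pstep Fail b = Fail"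

text \<open>Spelling out the consumed prefix makes soundness of the parser an invariant: a word that
  leads to \<open>Done\<close> is itself the encoding of the instance, with canonical
  numbers.\<close>

primrec unparse_target :: "target \<Rightarrow> bool list" where
  "unparse_target (TLit cs ls b) = items enc_clause cs @ True # items enc_lit ls @ [True, b]"
| "unparse_target (TX cs) = enc_list enc_clause cs"
| "unparse_target (TK cs x) = enc_list enc_clause cs @ enc_nat x"

primrec unparse :: "pstate \<Rightarrow> bool list" where
  "unparse (Clauses cs) = items enc_clause cs"
| "unparse (InClause cs ls) = items enc_clause cs @ True # items enc_lit ls"
| "unparse (Sign cs ls) = items enc_clause cs @ True # items enc_lit ls @ [True]"
| "unparse (Bits t bs) = unparse_target t @ items (\<lambda>b. [b]) bs"
| "unparse (Bit t bs) = unparse_target t @ items (\<lambda>b. [b]) bs @ [True]"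
| "unparse (Done cs x k) = enc_instance cs x k"
| "unparse Fail = []"

abbreviation parse :: "bool list \<Rightarrow> pstate" where
  "parse \<equiv> foldl pstep (Clauses [])"

lemma unparse_finish:
  assumes "canonical bs"
  shows "unparse (finish t (number bs)) = unparse_target t @ items (\<lambda>b. [b]) bs @ [False]"
  using bits_of_number[OF assms]
  by (cases t) (auto simp: mk_lit_def enc_nat_def enc_list_def enc_instance_def)

lemma unparse_pstep: "pstep q b \<noteq> Fail \<Longrightarrow> unparse (pstep q b) = unparse q @ [b]"
  by (cases q) (auto simp: enc_list_def unparse_finish split: if_splits)

lemma unparse_parse: "parse w \<noteq> Fail \<Longrightarrow> unparse (parse w) = w"
proof (induction w rule: rev_induct)
  case (snoc b w)
  then have "parse w \<noteq> Fail" by auto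
  then show ?case using snoc unparse_pstep by simp
qed simp

lemma foldl_pstep_bits: "foldl pstep (Bits t bs) (items (\<lambda>b. [b]) bs') = Bits t (bs @ bs')"
  by (induction bs' arbitrary: bs) auto

lemma foldl_pstep_nat: "foldl pstep (Bits t []) (enc_nat n) = finish t n"
  by (simp add: enc_nat_def enc_list_def foldl_pstep_bits)

lemma foldl_pstep_lits: "foldl pstep (InClause cs ls) (items enc_lit ls') = InClause cs (ls @ ls')"
proof (induction ls' arbitrary: ls)
  case (Cons l ls')
  then show ?case by (cases l) (auto simp: foldl_pstep_nat mk_lit_def)
qed simp

lemma foldl_pstep_clauses: "foldl pstep (Clauses cs) (items enc_clause cs') = Clauses (cs @ cs')"
  by (induction cs' arbitrary: cs) (auto simp: enc_list_def foldl_pstep_lits)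

lemma parse_enc_instance: "parse (enc_instance cs x k) = Done cs x k"
proof -
  have "enc_list enc_clause cs = items enc_clause cs @ [False]" by (simp add: enc_list_def)
  then show ?thesis by (simp add: enc_instance_def foldl_pstep_clauses foldl_pstep_nat)
qed

lemma parse_eq_Done_iff: "parse w = Done cs x k \<longleftrightarrow> w = enc_instance cs x k"
  using unparse_parse[of w] parse_enc_instance by auto

text \<open>Each clause has at least its announcing \<open>True\<close> and its closing
  \<open>False\<close>. As it adds at most two edges, the edge list is no longer than the
  input.\<close>

lemma length_enc_instance: "2 * length cs \<le> length (enc_instance cs x k)"
proof -
  have "2 * length cs \<le> length (items enc_clause cs)"
    by (induction cs) (auto simp: enc_list_def)
  then show ?thesis by (simp add: enc_instance_def enc_list_def)
qed

text \<open>Codes of literals serve as array indices. They can be exponential in the length of the input,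
  but memory access has unit cost.\<close>

fun code :: "nat lit \<Rightarrow> nat" where
  "code (Pos v) = 2 * v + 1"
| "code (Neg v) = 2 * v"

lemma code_eq_iff [simp]: "code a = code b \<longleftrightarrow> a = b"
  by (cases a; cases b) (auto, presburger+)

lemma code_surj: obtains l where "n = code l"
  by (metis code.simps evenE oddE)

section \<open>Recognizing Krom clauses, and the parser as a loop program\<close>

definition krom_clause :: "nat lit set \<Rightarrow> bool" where
  "krom_clause C \<longleftrightarrow> is_clause C \<and> card C \<le> 2"

lemma formula_of_krom_iff: "formula_of cs \<in> krom \<longleftrightarrow> (\<forall>ls\<in>set cs. krom_clause (set ls))"
  by (auto simp: krom_def cnf_def formula_of_def krom_clause_def)

lemma krom_clause_subset: "krom_clause D \<Longrightarrow> C \<subseteq> D \<Longrightarrow> krom_clause C"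
  unfolding krom_clause_def is_clause_def
  by (meson card_mono finite_subset order_trans subsetD)

lemma krom_clause_empty [simp]: "krom_clause {}"
  by (simp add: krom_clause_def is_clause_def)

lemma krom_clause_single [simp]: "krom_clause {l}"
  by (cases l) (simp_all add: krom_clause_def is_clause_def)

lemma is_clause_iff: "is_clause C \<longleftrightarrow> finite C \<and> (\<forall>a\<in>C. compl a \<notin> C)"
  unfolding is_clause_def by (metis compl.simps lit.exhaust)

text \<open>The case distinction made by \<open>add_literal\<close>; \<open>a = b\<close> stands for
  a clause with one literal so far.\<close>

lemma krom_clause_insert:
  assumes "krom_clause {a, b}"
  shows "krom_clause {l, a, b} \<longleftrightarrow> l \<noteq> compl a \<and> l \<noteq> compl b \<and> (l = a \<or> l = b \<or> a = b)"
  using assms by (auto simp: krom_clause_def is_clause_iff card_insert_if)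

text \<open>With truncated subtraction one of the two differences is 0, so their sum is the absolute
  difference, and 1 minus it is 1 just for equal values.\<close>

definition eq_e :: "expr \<Rightarrow> expr \<Rightarrow> expr" where
  "eq_e a b = Minus (Num 1) (Plus (Minus a b) (Minus b a))"

abbreviation less_e :: "expr \<Rightarrow> expr \<Rightarrow> expr" where
  "less_e a b \<equiv> Minus b a"

lemma eval_eq_e [simp]: "eval w s (eq_e a b) = (if eval w s a = eval w s b then 1 else 0)"
  by (simp add: eq_e_def)

text \<open>\<open>Mode\<close> and \<open>Tgt\<close> number the constructors of
  \<open>pstate\<close> and \<open>target\<close> in order. \<open>Top\<close> tells whether the
  bits read are canonical, so it starts at 1; \<open>Pow\<close> is the weight of the next
  bit.\<close>

definition start_number :: "nat \<Rightarrow> com" where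
  "start_number t = (Set Tgt (Num t) ;; Set Val (Num 0) ;; Set Pow (Num 1) ;; Set Top (Num 1) ;;
     Set Mode (Num 3))"

definition add_edge :: "scal \<Rightarrow> scal \<Rightarrow> com" where
  "add_edge x y = (Put From (Var NE) (Var x) ;; Put To (Var NE) (Var y) ;;
     Set NE (Plus (Var NE) (Num 1)))"

text \<open>\<open>CA\<close> and \<open>CB\<close> are the complements of \<open>LA\<close> and
  \<open>LB\<close>. A unit clause has \<open>LA = LB\<close> and enters its edge twice, so every
  nonempty clause adds two entries. The empty clause leaves only a flag.\<close>

definition close_clause :: com where
  "close_clause = (If (Var Cnt) (add_edge CA LB ;; add_edge CB LA) (Set Empty (Num 1)) ;;
     Set Mode (Num 0))"

text \<open>\<open>Co\<close> tabulates complements while variable and sign are at hand, since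
  expressions have no parity test to recover them from a code. \<open>Bad\<close> is set for a
  complementary pair or a third distinct literal.\<close>

definition add_literal :: com where
  "add_literal =
    (Set Lit (Plus (Plus (Var Val) (Var Val)) (Var Sgn)) ;;
     Set Col (Plus (Plus (Var Val) (Var Val)) (Minus (Num 1) (Var Sgn))) ;;
     Put Co (Var Lit) (Var Col) ;; Put Co (Var Col) (Var Lit) ;; Put Occ (Var Val) (Num 1) ;;
     If (Var Cnt)
       (If (Plus (eq_e (Var Lit) (Var CA)) (eq_e (Var Lit) (Var CB))) (Set Bad (Num 1))
         (If (Plus (eq_e (Var Lit) (Var LA)) (eq_e (Var Lit) (Var LB))) Skip
           (If (eq_e (Var Cnt) (Num 1))
             (Set LB (Var Lit) ;; Set CB (Var Col) ;; Set Cnt (Num 2))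
             (Set Bad (Num 1)))))
       (Set LA (Var Lit) ;; Set LB (Var Lit) ;; Set CA (Var Col) ;; Set CB (Var Col) ;;
        Set Cnt (Num 1)) ;;
     Set Mode (Num 1))"

definition end_number :: com where
  "end_number =
    If (Var Top)
      (If (eq_e (Var Tgt) (Num 0)) add_literal
        (If (eq_e (Var Tgt) (Num 1)) (Set XV (Var Val) ;; start_number 2)
          (Set KV (Var Val) ;; Set Mode (Num 5))))
      (Set Mode (Num 6))"

definition parse_step :: com where
  "parse_step =
    (Set Sym (Minus (Inp (Var P)) (Num 1)) ;;
     If (eq_e (Var Mode) (Num 0)) (If (Var Sym) (Set Cnt (Num 0) ;; Set Mode (Num 1)) (start_number 1))
    (If (eq_e (Var Mode) (Num 1)) (If (Var Sym) (Set Mode (Num 2)) close_clause)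
    (If (eq_e (Var Mode) (Num 2)) (Set Sgn (Var Sym) ;; start_number 0)
    (If (eq_e (Var Mode) (Num 3)) (If (Var Sym) (Set Mode (Num 4)) end_number)
    (If (eq_e (Var Mode) (Num 4))
      (If (Var Sym) (Set Val (Plus (Var Val) (Var Pow))) Skip ;; Set Top (Var Sym) ;;
       Set Pow (Plus (Var Pow) (Var Pow)) ;; Set Mode (Num 3))
      (Set Mode (Num 6)))))))"

section \<open>Invariants of the parser\<close>

definition edge_at :: "state \<Rightarrow> nat \<Rightarrow> nat \<Rightarrow> bool" where
  "edge_at s i j \<longleftrightarrow> (\<exists>e < s (S NE). s (A From e) = i \<and> s (A To e) = j)"

text \<open>\<open>ls\<close> is the unfinished clause. The edges are junk once \<open>Bad\<close> is set.\<close>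

definition formula_inv :: "nat lit list list \<Rightarrow> nat lit list \<Rightarrow> state \<Rightarrow> bool" where
  "formula_inv cs ls s \<longleftrightarrow>
     s (S Ans) = 0 \<and> s (S Near) = 0 \<and> s (S Good) = 0 \<and> s (S Unsat) = 0 \<and>
     (\<forall>i. s (A Dist i) = 0) \<and>
     (s (S Bad) = 0 \<longleftrightarrow> (\<forall>C\<in>set cs. krom_clause (set C)) \<and> krom_clause (set ls)) \<and>
     (s (S Bad) = 0 \<longrightarrow> (s (S Empty) > 0 \<longleftrightarrow> [] \<in> set cs)) \<and>
     s (S NE) \<le> 2 * length cs \<and>
     (s (S Bad) = 0 \<longrightarrow> (\<forall>a b. edge (formula_of cs) a b \<longleftrightarrow> edge_at s (code a) (code b))) \<and>
     (\<forall>C\<in>insert ls (set cs). \<forall>l\<in>set C. s (A Co (code l)) = code (compl l) \<and>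
        s (A Co (code (compl l))) = code l) \<and>
     (\<forall>v. s (A Occ v) > 0 \<longleftrightarrow> v \<in> var_of ` \<Union>(set ` insert ls (set cs)))"

text \<open>\<open>a = b\<close> stands for a single literal. Nothing is claimed once
  \<open>Bad\<close> is set, as rejected literals are not stored.\<close>

definition clause_inv :: "nat lit list \<Rightarrow> state \<Rightarrow> bool" where
  "clause_inv ls s \<longleftrightarrow> s (S Bad) = 0 \<longrightarrow>
     s (S Cnt) = card (set ls) \<and>
     (ls \<noteq> [] \<longrightarrow> (\<exists>a b. set ls = {a, b} \<and> s (S LA) = code a \<and> s (S LB) = code b \<and>
        s (S CA) = code (compl a) \<and> s (S CB) = code (compl b)))"

fun target_inv :: "target \<Rightarrow> state \<Rightarrow> bool" where
  "target_inv (TLit cs ls b) s \<longleftrightarrow>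
     s (S Tgt) = 0 \<and> s (S Sgn) = of_bool b \<and> formula_inv cs ls s \<and> clause_inv ls s"
| "target_inv (TX cs) s \<longleftrightarrow> s (S Tgt) = 1 \<and> formula_inv cs [] s"
| "target_inv (TK cs x) s \<longleftrightarrow> s (S Tgt) = 2 \<and> s (S XV) = x \<and> formula_inv cs [] s"

definition number_inv :: "bool list \<Rightarrow> state \<Rightarrow> bool" where
  "number_inv bs s \<longleftrightarrow> s (S Val) = number bs \<and> s (S Pow) = 2 ^ length bs \<and>
     (s (S Top) > 0 \<longleftrightarrow> canonical bs)"

fun parse_inv :: "pstate \<Rightarrow> state \<Rightarrow> bool" where
  "parse_inv (Clauses cs) s \<longleftrightarrow> s (S Mode) = 0 \<and> formula_inv cs [] s"
| "parse_inv (InClause cs ls) s \<longleftrightarrow> s (S Mode) = 1 \<and> formula_inv cs ls s \<and> clause_inv ls s"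
| "parse_inv (Sign cs ls) s \<longleftrightarrow> s (S Mode) = 2 \<and> formula_inv cs ls s \<and> clause_inv ls s"
| "parse_inv (Bits t bs) s \<longleftrightarrow> s (S Mode) = 3 \<and> target_inv t s \<and> number_inv bs s"
| "parse_inv (Bit t bs) s \<longleftrightarrow> s (S Mode) = 4 \<and> target_inv t s \<and> number_inv bs s"
| "parse_inv (Done cs x k) s \<longleftrightarrow>
     s (S Mode) = 5 \<and> formula_inv cs [] s \<and> s (S XV) = x \<and> s (S KV) = k"
| "parse_inv Fail s \<longleftrightarrow> s (S Mode) = 6 \<and> s (S Ans) = 0"

lemma formula_inv_upd [simp]:
  "x \<notin> {Ans, Near, Good, Unsat, Bad, Empty, NE} \<Longrightarrow>
    formula_inv cs ls (s(S x := v)) \<longleftrightarrow> formula_inv cs ls s"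
  by (cases x) (simp_all add: formula_inv_def edge_at_def)

lemma clause_inv_upd [simp]:
  "x \<notin> {Bad, Cnt, LA, LB, CA, CB} \<Longrightarrow> clause_inv ls (s(S x := v)) \<longleftrightarrow> clause_inv ls s"
  by (cases x) (simp_all add: clause_inv_def)

lemma target_inv_upd [simp]:
  "x \<in> {Mode, Sym, Val, Pow, Top} \<Longrightarrow> target_inv t (s(S x := v)) \<longleftrightarrow> target_inv t s"
  by (cases t) auto

lemma edge_formula_of_snoc:
  "edge (formula_of (cs @ [ls])) a b \<longleftrightarrow> edge (formula_of cs) a b \<or> {compl a, b} = set ls"
  by (auto simp: edge_def formula_of_def)

lemma edge_at_upd [simp]: "x \<noteq> NE \<Longrightarrow> edge_at (s(S x := v)) i j \<longleftrightarrow> edge_at s i j"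
  by (auto simp: edge_at_def)

lemma edge_at_add_edge:
  "x \<noteq> NE \<Longrightarrow> y \<noteq> NE \<Longrightarrow>
    edge_at (den w (add_edge x y) s) i j \<longleftrightarrow> edge_at s i j \<or> (i = s (S x) \<and> j = s (S y))"
  unfolding edge_at_def add_edge_def
  by (simp add: less_Suc_eq conj_disj_distribR ex_disj_distrib cong: conj_cong) auto

lemma add_edge_other [simp]:
  "den w (add_edge x y) s (S z) = (if z = NE then Suc (s (S NE)) else s (S z))"
  "a \<noteq> From \<Longrightarrow> a \<noteq> To \<Longrightarrow> den w (add_edge x y) s (A a i) = s (A a i)"
  by (auto simp: add_edge_def)

lemma close_clause_inv:
  assumes "formula_inv cs ls s" "clause_inv ls s"
  shows "parse_inv (Clauses (cs @ [ls])) (den w close_clause s)"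
proof (cases "s (S Bad) = 0")
  case False
  then show ?thesis using assms
    by (auto simp: close_clause_def formula_inv_def)
next
  case True
  show ?thesis
  proof (cases "ls = []")
    case empty: True
    have "{compl a, b} \<noteq> set ls" for a b :: "nat lit" using empty by simp
    then show ?thesis using assms True empty
      by (simp add: close_clause_def formula_inv_def clause_inv_def edge_formula_of_snoc edge_at_def)
  next
    case False
    then obtain a b where ab: "set ls = {a, b}" "s (S LA) = code a" "s (S LB) = code b"
        "s (S CA) = code (compl a)" "s (S CB) = code (compl b)" "s (S Cnt) = card (set ls)"
      using assms True by (auto simp: clause_inv_def)
    have cnt: "s (S Cnt) > 0" using ab False by (simp add: card_gt_0_iff)
    have "{compl u, v} = set ls \<longleftrightarrow> u = compl a \<and> v = b \<or> u = compl b \<and> v = a" for u v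
      using ab(1) by (metis compl_compl doubleton_eq_iff)
    then have e: "edge (formula_of (cs @ [ls])) u v \<longleftrightarrow>
        edge_at (den w close_clause s) (code u) (code v)" for u v
      using assms(1) True ab(2-5) cnt
      by (auto simp: close_clause_def edge_formula_of_snoc edge_at_add_edge formula_inv_def)
    show ?thesis
      using assms(1) True cnt False e unfolding formula_inv_def parse_inv.simps
      by (auto simp: close_clause_def)
  qed
qed

lemma code_mk_lit:
  "code (mk_lit b n) = n + n + of_bool b" "code (compl (mk_lit b n)) = n + n + (1 - of_bool b)"
  "var_of (mk_lit b n) = n"
  by (auto simp: mk_lit_def)

lemma add_literal_inv:
  assumes F: "formula_inv cs ls s" and C: "clause_inv ls s"
    and val: "s (S Val) = n" "s (S Sgn) = of_bool b"
  shows "parse_inv (InClause cs (ls @ [mk_lit b n])) (den w add_literal s)"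
proof -
  define l where "l = mk_lit b n"
  \<comment> \<open>The state after the unconditional assignments, from which the conditional
    starts.\<close>
  define s1 where "s1 = s(S Lit := code l, S Col := code (compl l), A Co (code l) := code (compl l),
    A Co (code (compl l)) := code l, A Occ n := 1)"
  let ?t = "den w add_literal s"
  have t: "?t = den w (If (Var Cnt)
       (If (Plus (eq_e (Var Lit) (Var CA)) (eq_e (Var Lit) (Var CB))) (Set Bad (Num 1))
         (If (Plus (eq_e (Var Lit) (Var LA)) (eq_e (Var Lit) (Var LB))) Skip
           (If (eq_e (Var Cnt) (Num 1))
             (Set LB (Var Lit) ;; Set CB (Var Col) ;; Set Cnt (Num 2))
             (Set Bad (Num 1)))))
       (Set LA (Var Lit) ;; Set LB (Var Lit) ;; Set CA (Var Col) ;; Set CB (Var Col) ;;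
        Set Cnt (Num 1)) ;;
     Set Mode (Num 1)) s1"
    using val unfolding s1_def l_def code_mk_lit add_literal_def by simp
  have same: "?t c = s c" if "c \<notin> {S Lit, S Col, S Bad, S LA, S LB, S CA, S CB, S Cnt, S Mode, A Occ n}"
      "\<And>i. c \<noteq> A Co i" for c
    using that unfolding t s1_def by (auto split: if_splits)
  have co: "?t (A Co i) = (if i = code l then code (compl l) else if i = code (compl l) then code l
      else s (A Co i))" for i
    unfolding t by (auto simp: s1_def)
  have occ: "?t (A Occ v) = (if v = n then 1 else s (A Occ v))" for v
    unfolding t by (auto simp: s1_def)
  have mode: "?t (S Mode) = 1" unfolding t by simp
  have bad: "(?t (S Bad) = 0 \<longleftrightarrow> s (S Bad) = 0 \<and> krom_clause (set (ls @ [l]))) \<and>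
      clause_inv (ls @ [l]) ?t"
  proof (cases "s (S Bad) = 0")
    case False
    then have "?t (S Bad) \<noteq> 0" unfolding t by (auto simp: s1_def)
    then show ?thesis using False by (simp add: clause_inv_def)
  next
    case True
    show ?thesis
    proof (cases "ls = []")
      case empty: True
      then show ?thesis
        using True C unfolding t clause_inv_def by (auto simp: s1_def)
    next
      case False
      then obtain a c where ac: "set ls = {a, c}" "s (S LA) = code a" "s (S LB) = code c"
          "s (S CA) = code (compl a)" "s (S CB) = code (compl c)" "s (S Cnt) = card (set ls)"
        using C True by (auto simp: clause_inv_def)
      have cnt: "s (S Cnt) = (if a = c then 1 else 2)" using ac by auto
      have k: "krom_clause {a, c}" using F True ac(1) by (simp add: formula_inv_def)
      \<comment> \<open>The outcomes of the nested conditional: complementary, repeated, second and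
        third literal.\<close>
      consider "l = compl a \<or> l = compl c" | "l \<noteq> compl a" "l \<noteq> compl c" "l = a \<or> l = c"
        | "l \<noteq> compl a" "l \<noteq> compl c" "l \<noteq> a" "l \<noteq> c" "a = c"
        | "l \<noteq> compl a" "l \<noteq> compl c" "l \<noteq> a" "l \<noteq> c" "a \<noteq> c" by blast
      then show ?thesis
      proof cases
        case 1
        then have "?t (S Bad) \<noteq> 0" unfolding t using ac cnt by (auto simp: s1_def)
        then show ?thesis using krom_clause_insert[OF k, of l] 1 ac(1) by (auto simp: clause_inv_def)
      next
        case 2
        then have "?t x = s1 x" if "x \<noteq> S Mode" for x
          using that unfolding t using ac cnt by (auto simp: s1_def)
        moreover have "set (ls @ [l]) = {a, c}" using ac(1) 2 by auto
        ultimately show ?thesis using k True ac cnt by (auto simp: clause_inv_def s1_def)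
      next
        case 3
        have "?t = s1(S LB := code l, S CB := code (compl l), S Cnt := 2, S Mode := 1)"
          unfolding t using ac cnt 3 by (simp add: s1_def)
        moreover have "set (ls @ [l]) = {a, l}" "card {a, l} = 2" using ac(1) 3 by auto
        ultimately show ?thesis
          using krom_clause_insert[OF k, of l] 3 True ac
          by (auto simp: clause_inv_def s1_def insert_commute)
      next
        case 4
        then have "?t (S Bad) \<noteq> 0" unfolding t using ac cnt by (auto simp: s1_def)
        then show ?thesis using krom_clause_insert[OF k, of l] 4 ac(1) by (auto simp: clause_inv_def)
      qed
    qed
  qed
  have "krom_clause (set (ls @ [l])) \<Longrightarrow> krom_clause (set ls)"
    by (erule krom_clause_subset) auto
  then have B: "?t (S Bad) = 0 \<longleftrightarrow> (\<forall>C\<in>set cs. krom_clause (set C)) \<and> krom_clause (set (ls @ [l]))"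
    using conjunct1[OF bad] F[unfolded formula_inv_def, THEN conjunct2, THEN conjunct2,
        THEN conjunct2, THEN conjunct2, THEN conjunct2, THEN conjunct1] by blast
  have E: "edge_at ?t = edge_at s"
    by (simp add: fun_eq_iff edge_at_def same)
  have K0: "s (A Co (code m)) = code (compl m) \<and> s (A Co (code (compl m))) = code m"
    if "C \<in> insert ls (set cs)" "m \<in> set C" for C m
    using F that by (auto simp: formula_inv_def)
  \<comment> \<open>The pair of entries for a variable is the same whichever of its literals is
    stored, so overwriting does no harm.\<close>
  have K: "?t (A Co (code m)) = code (compl m) \<and> ?t (A Co (code (compl m))) = code m"
    if "C \<in> insert (ls @ [l]) (set cs)" "m \<in> set C" for C m
    using that K0[of ls m] K0[of C m] by (auto simp: co)
  have "s (A Occ v) > 0 \<longleftrightarrow> v \<in> var_of ` \<Union>(set ` insert ls (set cs))" for v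
    using F by (simp add: formula_inv_def)
  then have O: "?t (A Occ v) > 0 \<longleftrightarrow> v \<in> var_of ` \<Union>(set ` insert (ls @ [l]) (set cs))" for v
    by (auto simp: occ l_def code_mk_lit(3))
  have "formula_inv cs (ls @ [l]) ?t"
    unfolding formula_inv_def E
  proof (intro conjI B)
    show "?t (S Bad) = 0 \<longrightarrow> (?t (S Empty) > 0 \<longleftrightarrow> [] \<in> set cs)"
      "?t (S Bad) = 0 \<longrightarrow> (\<forall>a b. edge (formula_of cs) a b \<longleftrightarrow> edge_at s (code a) (code b))"
      using F bad unfolding formula_inv_def by (simp_all add: same)
  qed (use F K O in \<open>auto simp: formula_inv_def same\<close>)
  then show ?thesis using bad mode unfolding l_def by simp
qed

lemma parse_step_inv:
  assumes inv: "parse_inv q s" and sym: "input_symbol w (s (S P)) = (if b then 2 else 1)"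
  shows "parse_inv (pstep q b) (den w parse_step s)"
proof (cases q)
  case (Clauses cs)
  then show ?thesis using inv sym
    by (auto simp: parse_step_def start_number_def number_inv_def canonical_def clause_inv_def
        formula_inv_def edge_at_def)
next
  case (InClause cs ls)
  then show ?thesis using inv sym close_clause_inv[of cs ls "s(S Sym := 0)" w]
    by (auto simp: parse_step_def)
next
  case (Sign cs ls)
  then show ?thesis using inv sym
    by (auto simp: parse_step_def start_number_def number_inv_def canonical_def)
next
  case (Bits t bs)
  show ?thesis
  proof (cases b)
    case True
    then show ?thesis using Bits inv sym by (simp add: parse_step_def number_inv_def)
  next
    case False
    have ans: "s (S Ans) = 0" using Bits inv by (cases t) (auto simp: formula_inv_def)
    have "den w parse_step s = den w end_number (s(S Sym := 0))"
      using False Bits inv sym by (simp add: parse_step_def)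
    then show ?thesis
      using False Bits inv ans add_literal_inv[of _ _ "s(S Sym := 0)" "number bs" _ w]
      by (cases t) (auto simp: end_number_def start_number_def number_inv_def canonical_def)
  qed
next
  case (Bit t bs)
  then show ?thesis using inv sym
    by (auto simp: parse_step_def number_inv_def number_append canonical_def)
next
  case (Done cs x k)
  then show ?thesis using inv sym by (auto simp: parse_step_def formula_inv_def)
next
  case Fail
  then show ?thesis using inv sym by (auto simp: parse_step_def)
qed

section \<open>Searching the implication graph\<close>

lemma den_For_induct [case_names init step]:
  assumes "I 0 s"
    and "\<And>i s. i < length w \<Longrightarrow> I i s \<Longrightarrow> I (Suc i) (den w c (s(S x := i)))"
  shows "I (length w) (den w (For x c) s)"
proof -
  have "I n (fold (\<lambda>i s. den w c (s(S x := i))) [0..<n] s)" if "n \<le> length w" for n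
    using that by (induction n) (auto simp: assms)
  then show ?thesis by simp
qed

lemma parse_inv_upd_P [simp]: "parse_inv q (s(S P := i)) \<longleftrightarrow> parse_inv q s"
proof -
  have "target_inv t (s(S P := i)) \<longleftrightarrow> target_inv t s" for t
    by (cases t) auto
  then show ?thesis by (cases q) (auto simp: number_inv_def)
qed

lemma parse_loop_inv: "parse_inv (parse w) (den w (For P parse_step) (\<lambda>_. 0))"
proof -
  have "parse_inv (parse (take (length w) w)) (den w (For P parse_step) (\<lambda>_. 0))"
  proof (induction rule: den_For_induct)
    case init
    show ?case
      by (auto simp: formula_inv_def edge_def formula_of_def edge_at_def)
  next
    case (step i s)
    have "parse (take (Suc i) w) = pstep (parse (take i w)) (w ! i)"
      using step(1) by (simp add: take_Suc_conv_app_nth)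
    moreover have "parse_inv (pstep (parse (take i w)) (w ! i)) (den w parse_step (s(S P := i)))"
      using step by (intro parse_step_inv) (auto simp: input_symbol_def)
    ultimately show ?case by simp
  qed
  then show ?thesis by simp
qed

text \<open>The least length of a walk satisfies both bounds at once: one makes
  \<open>length w\<close> rounds sufficient, the other preserves the comparison with a given
  length.\<close>

lemma relpowp_finite_bounded:
  fixes r :: "'a \<Rightarrow> 'a \<Rightarrow> bool"
  assumes "finite {(x, y). r x y}" "card {(x, y). r x y} \<le> N" "(r ^^ n) a b"
  obtains m where "m \<le> n" "m \<le> N" "(r ^^ m) a b"
proof -
  let ?S = "{(x, y). r x y}"
  have eq: "(a, b) \<in> ?S ^^ m \<longleftrightarrow> (r ^^ m) a b" for m
    using relpowp_relpow_eq[of m ?S] by (auto simp: fun_eq_iff)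
  define m where "m = (LEAST m. (r ^^ m) a b)"
  have m: "(r ^^ m) a b" "m \<le> n"
    unfolding m_def using assms(3) by (auto intro: LeastI Least_le)
  obtain m' where "m' \<le> card ?S" "(r ^^ m') a b"
    using relpow_finite_bounded[OF assms(1), of m] m(1) eq by blast
  then have "m \<le> card ?S" unfolding m_def using Least_le order_trans by metis
  then show ?thesis using that m assms(2) by simp
qed

text \<open>0 stands for infinity, so a target entry is lowered if it is 0 or too large, and only
  from a nonzero source entry.\<close>

definition relax :: com where
  "relax = For E (If (less_e (Var E) (Var NE))
    (If (Get Dist (Get From (Var E)))
      (If (Plus (eq_e (Get Dist (Get To (Var E))) (Num 0))
              (less_e (Plus (Get Dist (Get From (Var E))) (Num 1)) (Get Dist (Get To (Var E)))))
        (Put Dist (Get To (Var E)) (Plus (Get Dist (Get From (Var E))) (Num 1)))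
        Skip)
      Skip)
    Skip)"

text \<open>The indices are codes, too many to be enumerated. Nonzero entries occur only at
  endpoints of edges, so resetting these suffices.\<close>

definition clear :: com where
  "clear = For J (If (less_e (Var J) (Var NE))
    (Put Dist (Get From (Var J)) (Num 0) ;; Put Dist (Get To (Var J)) (Num 0)) Skip)"

text \<open>Bellman--Ford, where \<open>Dist\<close> holds one more than the distance, or 0 for infinity.\<close>

definition bellman_ford :: com where
  "bellman_ford = (clear ;; Put Dist (Var Src) (Num 1) ;; For R relax)"

section \<open>Correctness of Bellman-Ford\<close>

definition scratch :: "cell set" where
  "scratch = {S J, S R, S E} \<union> range (A Dist)"

definition unchanged :: "cell set \<Rightarrow> state \<Rightarrow> state \<Rightarrow> bool" where
  "unchanged V s t \<longleftrightarrow> (\<forall>c. c \<notin> V \<longrightarrow> t c = s c)"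

lemma unchanged_scratch:
  assumes "unchanged scratch s t"
  shows "x \<notin> {J, R, E} \<Longrightarrow> t (S x) = s (S x)" "a \<noteq> Dist \<Longrightarrow> t (A a i) = s (A a i)"
  using assms by (auto simp: unchanged_def scratch_def)

definition endpoint :: "state \<Rightarrow> nat \<Rightarrow> bool" where
  "endpoint s i \<longleftrightarrow> (\<exists>j. edge_at s i j \<or> edge_at s j i)"

definition dist_sound :: "state \<Rightarrow> nat \<Rightarrow> state \<Rightarrow> bool" where
  "dist_sound s src t \<longleftrightarrow> (\<forall>j. t (A Dist j) > 0 \<longrightarrow> (edge_at s ^^ (t (A Dist j) - 1)) src j)"

text \<open>Updates happen in place, so a round may profit from entries made in the same round:
  lengths of walks bound the entries only from above, whereas soundness ties each entry to a walk of
  exactly its length.\<close>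

definition dist_complete :: "state \<Rightarrow> nat \<Rightarrow> nat \<Rightarrow> state \<Rightarrow> bool" where
  "dist_complete s src r t \<longleftrightarrow>
    (\<forall>n\<le>r. \<forall>j. (edge_at s ^^ n) src j \<longrightarrow> 0 < t (A Dist j) \<and> t (A Dist j) \<le> Suc n)"

lemma relax_correct:
  assumes "unchanged scratch s t" "s (S NE) \<le> length w"
    and "dist_sound s src t" "dist_complete s src r t"
  shows "unchanged scratch s (den w relax t) \<and> dist_sound s src (den w relax t) \<and>
    dist_complete s src (Suc r) (den w relax t)"
proof -
  \<comment> \<open>The last conjunct is what the edges already treated contribute to completeness
    for \<open>Suc r\<close>: a walk of length \<open>n\<close> to the source bounds the entry at
    the target.\<close>
  define I where "I i u \<longleftrightarrow> unchanged scratch s u \<and> dist_sound s src u \<and> dist_complete s src r u \<and>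
    (\<forall>e<i. e < s (S NE) \<longrightarrow> (\<forall>n\<le>r. (edge_at s ^^ n) src (s (A From e)) \<longrightarrow>
      0 < u (A Dist (s (A To e))) \<and> u (A Dist (s (A To e))) \<le> Suc (Suc n)))" for i u
  have "I (length w) (den w relax t)"
    unfolding relax_def
  proof (induction rule: den_For_induct)
    case init
    show ?case using assms by (simp add: I_def)
  next
    case (step i u)
    let ?f = "s (A From i)" and ?t = "s (A To i)"
    let ?D = "\<lambda>j. u (A Dist j)"
    define b where "b \<longleftrightarrow> i < s (S NE) \<and> 0 < ?D ?f \<and> (?D ?t = 0 \<or> Suc (?D ?f) < ?D ?t)"
    have un: "unchanged scratch s u" using step by (simp add: I_def)
    let ?u = "u(S E := i)"
    let ?v = "if b then ?u(A Dist ?t := Suc (?D ?f)) else ?u"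
    have "den w (If (less_e (Var E) (Var NE))
      (If (Get Dist (Get From (Var E)))
        (If (Plus (eq_e (Get Dist (Get To (Var E))) (Num 0))
                (less_e (Plus (Get Dist (Get From (Var E))) (Num 1)) (Get Dist (Get To (Var E)))))
          (Put Dist (Get To (Var E)) (Plus (Get Dist (Get From (Var E))) (Num 1)))
          Skip)
        Skip)
      Skip) ?u = ?v"
      by (auto simp: b_def unchanged_scratch[OF un])
    moreover have "I (Suc i) ?v"
    proof -
      \<comment> \<open>Nonzero entries never grow and never return to 0, so earlier bounds
        persist.\<close>
      have mono: "0 < ?D j \<Longrightarrow> 0 < ?v (A Dist j) \<and> ?v (A Dist j) \<le> ?D j" for j
        by (auto simp: b_def)
      have "unchanged scratch s ?v"
        using un by (auto simp: unchanged_def scratch_def)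
      moreover have "dist_sound s src ?v"
      proof (cases b)
        case True
        then have "edge_at s ?f ?t" by (auto simp: b_def edge_at_def)
        moreover have "(edge_at s ^^ (?D ?f - 1)) src ?f"
          using step True by (simp add: I_def dist_sound_def b_def)
        ultimately have "(edge_at s ^^ Suc (?D ?f - 1)) src ?t" by auto
        moreover have "Suc (?D ?f - 1) = ?D ?f" using True by (simp add: b_def)
        ultimately have "(edge_at s ^^ ?D ?f) src ?t" by (simp only:)
        then show ?thesis using True step by (auto simp: I_def dist_sound_def)
      next
        case False
        then show ?thesis using step by (auto simp: I_def dist_sound_def)
      qed
      moreover have comp: "dist_complete s src r ?v"
        unfolding dist_complete_def
      proof (intro allI impI)
        fix n j assume "n \<le> r" "(edge_at s ^^ n) src j"
        then have "0 < ?D j \<and> ?D j \<le> Suc n" using step by (auto simp: I_def dist_complete_def)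
        then show "0 < ?v (A Dist j) \<and> ?v (A Dist j) \<le> Suc n" using mono[of j] by linarith
      qed
      moreover have "0 < ?v (A Dist (s (A To e))) \<and> ?v (A Dist (s (A To e))) \<le> Suc (Suc n)"
        if e: "e < Suc i" "e < s (S NE)" "n \<le> r" "(edge_at s ^^ n) src (s (A From e))" for e n
      proof (cases "e = i")
        case True
        have "0 < ?D ?f" "?D ?f \<le> Suc n"
          using step e True by (auto simp: I_def dist_complete_def)
        then show ?thesis using True e(2) by (auto simp: b_def)
      next
        case False
        then have "0 < ?D (s (A To e)) \<and> ?D (s (A To e)) \<le> Suc (Suc n)"
          using step e by (auto simp: I_def)
        then show ?thesis using mono[of "s (A To e)"] by linarith
      qed
      ultimately show ?thesis unfolding I_def by blast
    qed
    ultimately show ?case by (simp only:)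
  qed
  moreover have "dist_complete s src (Suc r) u" if "I (length w) u" for u
    unfolding dist_complete_def
  proof (intro allI impI)
    fix n j assume n: "n \<le> Suc r" "(edge_at s ^^ n) src j"
    show "0 < u (A Dist j) \<and> u (A Dist j) \<le> Suc n"
    proof (cases "n \<le> r")
      case True
      then show ?thesis using that n by (simp add: I_def dist_complete_def)
    next
      case False
      then obtain i where i: "(edge_at s ^^ r) src i" "edge_at s i j" and "n = Suc r"
        using n by (metis le_SucE relpowp_Suc_E)
      then obtain e where "e < s (S NE)" "s (A From e) = i" "s (A To e) = j"
        by (auto simp: edge_at_def)
      then show ?thesis
        using that i \<open>n = Suc r\<close> assms(2) unfolding I_def by (metis order_less_le_trans order_refl)
    qed
  qed
  ultimately show ?thesis by (auto simp: I_def)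
qed

lemma clear_correct:
  assumes "s (S NE) \<le> length w" "\<And>i. s (A Dist i) > 0 \<Longrightarrow> endpoint s i"
  shows "unchanged scratch s (den w clear s)" "den w clear s (A Dist i) = 0"
proof -
  \<comment> \<open>A surviving nonzero entry belongs to no edge treated so far; after all edges
    this contradicts being an endpoint.\<close>
  define I where "I i u \<longleftrightarrow> unchanged scratch s u \<and>
    (\<forall>j. u (A Dist j) > 0 \<longrightarrow> endpoint s j \<and> (\<forall>e<i. e < s (S NE) \<longrightarrow> s (A From e) \<noteq> j \<and> s (A To e) \<noteq> j))" for i u
  have "I (length w) (den w clear s)"
    unfolding clear_def
  proof (induction rule: den_For_induct)
    case init
    show ?case using assms(2) by (simp add: I_def unchanged_def)
  next
    case (step i u)
    have un: "unchanged scratch s u" using step by (simp add: I_def)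
    have "I (Suc i) (u(S J := i))" if "\<not> i < s (S NE)"
      using step that by (auto simp: I_def unchanged_def scratch_def less_Suc_eq)
    moreover have "I (Suc i) (u(S J := i, A Dist (s (A From i)) := 0, A Dist (s (A To i)) := 0))"
      using step by (auto simp: I_def unchanged_def scratch_def less_Suc_eq)
    ultimately show ?case by (simp add: unchanged_scratch[OF un])
  qed
  then have "unchanged scratch s (den w clear s) \<and> (\<forall>j. den w clear s (A Dist j) = 0)"
    using assms(1) unfolding I_def endpoint_def edge_at_def
    by (metis not_gr_zero order_less_le_trans)
  then show "unchanged scratch s (den w clear s)" "den w clear s (A Dist i) = 0" by blast+
qed

text \<open>A shortest walk is no longer than the number of edges, which is at most
  \<open>length w\<close>, so completeness after \<open>length w\<close> rounds extends to all
  lengths. The next \<open>clear\<close> relies on entries being 0 away from endpoints; this needs a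
  source that is an endpoint.\<close>

lemma bellman_ford_correct:
  assumes "s (S NE) \<le> length w" "\<And>i. s (A Dist i) > 0 \<Longrightarrow> endpoint s i" "endpoint s (s (S Src))"
  defines "t \<equiv> den w bellman_ford s"
  shows "unchanged scratch s t"
    and "t (A Dist i) > 0 \<Longrightarrow> endpoint s i"
    and "0 < t (A Dist i) \<and> t (A Dist i) \<le> Suc k \<longleftrightarrow> (\<exists>n\<le>k. (edge_at s ^^ n) (s (S Src)) i)"
    and "0 < t (A Dist i) \<longleftrightarrow> (edge_at s)\<^sup>*\<^sup>* (s (S Src)) i"
proof -
  let ?src = "s (S Src)"
  define I where "I r u \<longleftrightarrow> unchanged scratch s u \<and> dist_sound s ?src u \<and> dist_complete s ?src r u" for r u
  note cl = clear_correct[OF assms(1,2)]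
  have "I (length w) (den w (For R relax) ((den w clear s)(A Dist ?src := 1)))"
  proof (induction rule: den_For_induct)
    case init
    show ?case using cl
      by (auto simp: I_def unchanged_def scratch_def dist_sound_def dist_complete_def)
  next
    case (step i u)
    then have "I i (u(S R := i))"
      by (auto simp: I_def unchanged_def scratch_def dist_sound_def dist_complete_def)
    then show ?case using relax_correct[of s "u(S R := i)" w ?src i] assms(1) unfolding I_def by blast
  qed
  moreover have "den w clear s (S Src) = ?src" using unchanged_scratch[OF cl(1)] by simp
  ultimately have I: "I (length w) t" by (simp add: t_def bellman_ford_def)
  show "unchanged scratch s t" using I by (simp add: I_def)
  have sound: "0 < t (A Dist i) \<Longrightarrow> (edge_at s ^^ (t (A Dist i) - 1)) ?src i" for i
    using I by (simp add: I_def dist_sound_def)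
  have edges: "{(i, j). edge_at s i j} = (\<lambda>e. (s (A From e), s (A To e))) ` {..<s (S NE)}"
    by (auto simp: edge_at_def)
  have fin: "finite {(i, j). edge_at s i j}" "card {(i, j). edge_at s i j} \<le> length w"
    unfolding edges using card_image_le[of "{..<s (S NE)}"] assms(1) by (auto intro: order_trans)
  have complete: "0 < t (A Dist i) \<and> t (A Dist i) \<le> Suc n" if walk: "(edge_at s ^^ n) ?src i" for n i
  proof -
    obtain m where "m \<le> n" "m \<le> length w" "(edge_at s ^^ m) ?src i"
      using relpowp_finite_bounded[OF fin walk] .
    then show ?thesis using I unfolding I_def dist_complete_def by (meson Suc_le_mono order_trans)
  qed
  show "0 < t (A Dist i) \<and> t (A Dist i) \<le> Suc k \<longleftrightarrow> (\<exists>n\<le>k. (edge_at s ^^ n) ?src i)"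
    using sound[of i] complete[of _ i] by (metis One_nat_def Suc_le_mono Suc_pred order_trans)
  show "0 < t (A Dist i) \<longleftrightarrow> (edge_at s)\<^sup>*\<^sup>* ?src i"
    using sound[of i] complete[of _ i] by (auto simp: rtranclp_power)
  show "endpoint s i" if pos: "t (A Dist i) > 0"
  proof -
    obtain n where "(edge_at s ^^ n) ?src i" using sound[OF pos] by blast
    then show ?thesis using assms(3)
      by (cases n) (auto simp: endpoint_def)
  qed
qed


text \<open>The candidate \<open>m\<close> is the target of edge \<open>M\<close>. Its distance from
  \<open>compl m\<close> is saved in \<open>D1\<close> before the search from \<open>m\<close>
  overwrites \<open>Dist\<close>. Entries are distances plus one, so a distance of at most
  \<open>KV\<close> reads \<open>D1 < KV + 2\<close>.\<close>

definition search_body :: com where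
  "search_body =
    (Set Src (Get Co (Get To (Var M))) ;; bellman_ford ;; Set D1 (Get Dist (Get To (Var M))) ;;
     Set Src (Get To (Var M)) ;; bellman_ford ;;
     Set Cyc (Get Dist (Get Co (Get To (Var M)))) ;;
     Set Hit (Plus (Get Dist (Plus (Var XV) (Var XV)))
       (Get Dist (Plus (Plus (Var XV) (Var XV)) (Num 1)))) ;;
     If (Var D1)
       (If (Var Cyc) (Set Unsat (Num 1)) Skip ;;
        If (less_e (Var D1) (Plus (Var KV) (Num 2)))
          (Set Near (Num 1) ;; If (Var Hit) (Set Good (Num 1)) Skip) Skip)
       Skip)"

definition search :: com where
  "search = For M (If (less_e (Var M) (Var NE)) search_body Skip)"

text \<open>\<open>Near\<close> and \<open>Unsat\<close> are combined only after the loop, since the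
  short walk and the contradiction may belong to different literals. The tests of \<open>KV\<close>
  and \<open>Occ\<close> enforce 1 \<le> k and that \<open>x\<close> occurs in the formula.\<close>

definition decider :: com where
  "decider =
    (For P parse_step ;;
     If (eq_e (Var Mode) (Num 5))
       (If (Var Bad) Skip
         (If (Var KV)
           (If (Get Occ (Var XV))
             (search ;; Set Ans (Plus (Var Empty) (Var Good)) ;;
              If (Var Near) (If (Var Unsat) (Set Ans (Num 1)) Skip) Skip)
             Skip)
           Skip))
       Skip)"

section \<open>Correctness of the search over edge targets\<close>

definition short_cycle :: "state \<Rightarrow> nat \<Rightarrow> nat \<Rightarrow> bool" where
  "short_cycle s k i \<longleftrightarrow> (\<exists>n\<le>k. (edge_at s ^^ n) (s (A Co i)) i)"

definition hits :: "state \<Rightarrow> nat \<Rightarrow> nat \<Rightarrow> bool" where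
  "hits s x i \<longleftrightarrow> (edge_at s)\<^sup>*\<^sup>* i (x + x) \<or> (edge_at s)\<^sup>*\<^sup>* i (x + x + 1)"

definition cyclic :: "state \<Rightarrow> nat \<Rightarrow> bool" where
  "cyclic s i \<longleftrightarrow> (edge_at s)\<^sup>*\<^sup>* (s (A Co i)) i \<and> (edge_at s)\<^sup>*\<^sup>* i (s (A Co i))"

definition found :: "state \<Rightarrow> nat \<Rightarrow> (nat \<Rightarrow> bool) \<Rightarrow> bool" where
  "found s i q \<longleftrightarrow> (\<exists>e<i. e < s (S NE) \<and> q (s (A To e)))"

lemma found_Suc: "found s (Suc i) q \<longleftrightarrow> found s i q \<or> (i < s (S NE) \<and> q (s (A To i)))"
  by (auto simp: found_def less_Suc_eq)

definition work :: "cell set" where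
  "work = scratch \<union> S ` {M, Src, D1, Cyc, Hit, Near, Good, Unsat}"

lemma unchanged_work:
  assumes "unchanged work s t"
  shows "x \<notin> {J, R, E, M, Src, D1, Cyc, Hit, Near, Good, Unsat} \<Longrightarrow> t (S x) = s (S x)"
    "a \<noteq> Dist \<Longrightarrow> t (A a i) = s (A a i)"
  using assms by (auto simp: unchanged_def work_def scratch_def)

lemma unchanged_work_edge_at: "unchanged work s t \<Longrightarrow> edge_at t = edge_at s"
  by (simp add: edge_at_def fun_eq_iff unchanged_work)

lemma unchanged_trans: "unchanged V s t \<Longrightarrow> unchanged V t u \<Longrightarrow> unchanged V s u"
  by (simp add: unchanged_def)

lemma unchanged_mono: "unchanged V s t \<Longrightarrow> V \<subseteq> W \<Longrightarrow> unchanged W s t"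
  by (auto simp: unchanged_def)

text \<open>Successive searches start from states \<open>u\<close> that differ from \<open>s\<close>
  only in working cells, so all results can refer to the edges of the fixed
  \<open>s\<close>.\<close>

lemma bellman_ford_from:
  assumes un: "unchanged work s u" and ne: "s (S NE) \<le> length w"
    and sup: "\<And>i. u (A Dist i) > 0 \<Longrightarrow> endpoint s i" and src: "endpoint s src"
  defines "t \<equiv> den w bellman_ford (u(S Src := src))"
  shows "unchanged work s t" "unchanged scratch (u(S Src := src)) t"
    and "t (A Dist i) > 0 \<Longrightarrow> endpoint s i"
    and "0 < t (A Dist i) \<and> t (A Dist i) \<le> Suc k \<longleftrightarrow> (\<exists>n\<le>k. (edge_at s ^^ n) src i)"
    and "0 < t (A Dist i) \<longleftrightarrow> (edge_at s)\<^sup>*\<^sup>* src i"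
proof -
  let ?u = "u(S Src := src)"
  have un': "unchanged work s ?u" using un by (auto simp: unchanged_def work_def)
  note e = unchanged_work_edge_at[OF un']
  have ep: "endpoint ?u = endpoint s" unfolding endpoint_def e by simp
  have 1: "?u (S NE) \<le> length w" using ne unchanged_work(1)[OF un', of NE] by simp
  have 2: "endpoint ?u i" if "?u (A Dist i) > 0" for i using sup that unfolding ep by simp
  have 3: "endpoint ?u (?u (S Src))" using src unfolding ep by simp
  note bf = bellman_ford_correct[of ?u w, OF 1 2 3, folded t_def, unfolded e ep fun_upd_same]
  show "unchanged work s t"
    by (rule unchanged_trans[OF un' unchanged_mono[OF bf(1)]]) (auto simp: work_def)
  show "unchanged scratch ?u t" by (rule bf(1))
  show "t (A Dist i) > 0 \<Longrightarrow> endpoint s i" by (rule bf(2))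
  show "0 < t (A Dist i) \<and> t (A Dist i) \<le> Suc k \<longleftrightarrow> (\<exists>n\<le>k. (edge_at s ^^ n) src i)"
    by (rule bf(3))
  show "0 < t (A Dist i) \<longleftrightarrow> (edge_at s)\<^sup>*\<^sup>* src i" by (rule bf(4))
qed

lemma search_correct:
  assumes ne: "s (S NE) \<le> length w" and z: "\<And>i. s (A Dist i) = 0"
    and init: "s (S Near) = 0" "s (S Good) = 0" "s (S Unsat) = 0"
    and xk: "s (S XV) = x" "s (S KV) = k"
    and co: "\<And>e. e < s (S NE) \<Longrightarrow> endpoint s (s (A Co (s (A To e))))"
  defines "t \<equiv> den w search s"
  shows "unchanged work s t"
    and "t (S Near) > 0 \<longleftrightarrow> (\<exists>e < s (S NE). short_cycle s k (s (A To e)))"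
    and "t (S Good) > 0 \<longleftrightarrow> (\<exists>e < s (S NE). short_cycle s k (s (A To e)) \<and> hits s x (s (A To e)))"
    and "t (S Unsat) > 0 \<longleftrightarrow> (\<exists>e < s (S NE). cyclic s (s (A To e)))"
proof -
  define I where "I i u \<longleftrightarrow> unchanged work s u \<and> (\<forall>j. u (A Dist j) > 0 \<longrightarrow> endpoint s j) \<and>
    (u (S Near) > 0 \<longleftrightarrow> found s i (short_cycle s k)) \<and>
    (u (S Good) > 0 \<longleftrightarrow> found s i (\<lambda>j. short_cycle s k j \<and> hits s x j)) \<and>
    (u (S Unsat) > 0 \<longleftrightarrow> found s i (cyclic s))" for i u
  have "I (length w) t"
    unfolding t_def search_def
  proof (induction rule: den_For_induct)
    case init
    show ?case using assms by (simp add: I_def unchanged_def found_def)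
  next
    case (step i u)
    let ?u = "u(S M := i)"
    have un: "unchanged work s ?u" using step by (auto simp: I_def unchanged_def work_def)
    have sup: "endpoint s j" if "?u (A Dist j) > 0" for j using step that by (simp add: I_def)
    show ?case
    proof (cases "i < s (S NE)")
      case False
      then have "den w (If (less_e (Var M) (Var NE)) search_body Skip) ?u = ?u"
        using unchanged_work(1)[OF un, of NE] by simp
      moreover have "I (Suc i) ?u" using step un False by (auto simp: I_def found_Suc)
      ultimately show ?thesis by (simp only:)
    next
      case True
      let ?q = "s (A To i)"
      let ?c = "s (A Co ?q)"
      have epq: "endpoint s ?q" using True by (auto simp: endpoint_def edge_at_def)
      define v where "v = den w bellman_ford (?u(S Src := ?c))"
      note v = bellman_ford_from[OF un ne sup co[OF True], folded v_def]
      let ?d1 = "v (A Dist ?q)"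
      let ?v = "v(S D1 := ?d1)"
      have un2: "unchanged work s ?v" using v(1) by (auto simp: unchanged_def work_def)
      have sup2: "endpoint s j" if "?v (A Dist j) > 0" for j using v(3) that by simp
      define t where "t = den w bellman_ford (?v(S Src := ?q))"
      note t = bellman_ford_from[OF un2 ne sup2 epq, folded t_def]
      have vM: "v (S M) = i" using unchanged_scratch(1)[OF v(2), of M] by simp
      have tM: "t (S M) = i" using unchanged_scratch(1)[OF t(2), of M] vM by simp
      have tD: "t (S D1) = ?d1" using unchanged_scratch(1)[OF t(2), of D1] by simp
      have flags: "t (S y) = u (S y)" if "y \<in> {Near, Good, Unsat}" for y
        using unchanged_scratch(1)[OF t(2), of y] unchanged_scratch(1)[OF v(2), of y] that by auto
      have tk: "t (S KV) = k" "t (S XV) = x" using unchanged_work(1)[OF t(1)] xk by simp_all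
      have tq: "t (A To i) = ?q" "t (A Co ?q) = ?c" using unchanged_work(2)[OF t(1)] by simp_all
      have vq: "v (A To i) = ?q" "v (A Co ?q) = ?c" using unchanged_work(2)[OF v(1)] by simp_all
      have uq: "?u (A To i) = ?q" "?u (A Co ?q) = ?c" using unchanged_work(2)[OF un] by simp_all
      define cyc where "cyc = t (A Dist ?c)"
      define hit where "hit = t (A Dist (x + x)) + t (A Dist (x + x + 1))"
      let ?t = "t(S Cyc := cyc, S Hit := hit)"
      \<comment> \<open>\<open>t1\<close>, \<open>t2\<close> and \<open>t3\<close> follow the
        updates of \<open>Unsat\<close>, \<open>Near\<close> and \<open>Good\<close>, with
        conditions shaped to match \<open>cyclic\<close>, \<open>short_cycle\<close> and
        \<open>hits\<close>.\<close>
      define t1 where "t1 = (if ?d1 > 0 \<and> cyc > 0 then ?t(S Unsat := 1) else ?t)"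
      define t2 where "t2 = (if ?d1 > 0 \<and> ?d1 < k + 2 then t1(S Near := 1) else t1)"
      define t3 where "t3 = (if ?d1 > 0 \<and> ?d1 < k + 2 \<and> hit > 0 then t2(S Good := 1) else t2)"
      have "den w search_body ?u = den w (
          Set Cyc (Get Dist (Get Co (Get To (Var M)))) ;;
          Set Hit (Plus (Get Dist (Plus (Var XV) (Var XV)))
            (Get Dist (Plus (Plus (Var XV) (Var XV)) (Num 1)))) ;;
          If (Var D1)
            (If (Var Cyc) (Set Unsat (Num 1)) Skip ;;
              If (less_e (Var D1) (Plus (Var KV) (Num 2)))
              (Set Near (Num 1) ;; If (Var Hit) (Set Good (Num 1)) Skip) Skip)
            Skip) t"
        using uq vq vM unfolding search_body_def by (simp add: v_def[symmetric] t_def[symmetric])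
      also have "\<dots> = den w (If (Var D1)
            (If (Var Cyc) (Set Unsat (Num 1)) Skip ;;
              If (less_e (Var D1) (Plus (Var KV) (Num 2)))
              (Set Near (Num 1) ;; If (Var Hit) (Set Good (Num 1)) Skip) Skip)
            Skip) ?t"
        using tM tk tq unfolding cyc_def hit_def by simp
      also have "\<dots> = t3"
        using tD tk unfolding t3_def t2_def t1_def by simp
      finally have body: "den w (If (less_e (Var M) (Var NE)) search_body Skip) ?u = t3"
        using True unchanged_work(1)[OF un, of NE] by simp
      have d1: "?d1 > 0 \<longleftrightarrow> (edge_at s)\<^sup>*\<^sup>* ?c ?q" by (rule v(5))
      have d1k: "?d1 > 0 \<and> ?d1 < k + 2 \<longleftrightarrow> short_cycle s k ?q"
        using v(4)[of ?q k] by (auto simp: short_cycle_def)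
      have hit: "hit > 0 \<longleftrightarrow> hits s x ?q" unfolding hit_def hits_def using t(5) by simp
      have cyc: "?d1 > 0 \<and> cyc > 0 \<longleftrightarrow> cyclic s ?q"
        unfolding cyc_def cyclic_def d1 using t(5) by simp
      have "unchanged work s t3"
        using t(1) unfolding t3_def t2_def t1_def by (auto simp: unchanged_def work_def)
      moreover have "t3 (A Dist j) = t (A Dist j)" for j
        unfolding t3_def t2_def t1_def by simp
      moreover have "t3 (S Near) = (if short_cycle s k ?q then 1 else u (S Near))"
        unfolding t3_def t2_def t1_def d1k[symmetric] using flags by simp
      moreover have "t3 (S Good) = (if short_cycle s k ?q \<and> hits s x ?q then 1 else u (S Good))"
        unfolding t3_def t2_def t1_def d1k[symmetric] hit[symmetric] using flags by simp
      moreover have "t3 (S Unsat) = (if cyclic s ?q then 1 else u (S Unsat))"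
        unfolding t3_def t2_def t1_def cyc[symmetric] using flags by simp
      ultimately have "I (Suc i) t3"
        using step(2) t(3) True unfolding I_def found_Suc by simp
      then show ?thesis unfolding body .
    qed
  qed
  then show "unchanged work s t"
    "t (S Near) > 0 \<longleftrightarrow> (\<exists>e < s (S NE). short_cycle s k (s (A To e)))"
    "t (S Good) > 0 \<longleftrightarrow> (\<exists>e < s (S NE). short_cycle s k (s (A To e)) \<and> hits s x (s (A To e)))"
    "t (S Unsat) > 0 \<longleftrightarrow> (\<exists>e < s (S NE). cyclic s (s (A To e)))"
    using ne unfolding I_def found_def by (auto dest: order_less_le_trans)
qed

section \<open>Correctness of the decision procedure\<close>

text \<open>Intermediate vertices are arbitrary numbers; as \<open>code\<close> is onto, each is the
  code of a literal.\<close>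

lemma edge_at_relpowp:
  assumes "\<And>a b. edge_at s (code a) (code b) \<longleftrightarrow> edge \<phi> a b"
  shows "(edge_at s ^^ n) (code a) (code b) \<longleftrightarrow> (edge \<phi> ^^ n) a b"
proof (induction n arbitrary: b)
  case (Suc n)
  have "(\<exists>i. (edge_at s ^^ n) (code a) i \<and> edge_at s i (code b)) \<longleftrightarrow>
      (\<exists>c. (edge_at s ^^ n) (code a) (code c) \<and> edge_at s (code c) (code b))"
    by (metis code_surj)
  then show ?case using Suc assms by (simp add: OO_def)
qed simp

lemma edge_at_reach:
  assumes "\<And>a b. edge_at s (code a) (code b) \<longleftrightarrow> edge \<phi> a b"
  shows "(edge_at s)\<^sup>*\<^sup>* (code a) (code b) \<longleftrightarrow> (edge \<phi>)\<^sup>*\<^sup>* a b"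
  using edge_at_relpowp[OF assms] by (simp add: rtranclp_power)

lemma ex_lit_var: "(\<exists>l. var_of l = x \<and> q l) \<longleftrightarrow> q (Neg x) \<or> q (Pos x)"
  by (metis lit.exhaust var_of.simps)

lemma reach_last:
  assumes "(edge \<phi>)\<^sup>*\<^sup>* a b" "a \<noteq> b"
  obtains c where "edge \<phi> c b"
  using assms by (metis rtranclp.cases)

lemma search_formula:
  assumes inv: "formula_inv cs [] s" and bad: "s (S Bad) = 0" and xk: "s (S XV) = x" "s (S KV) = k"
    and len: "2 * length cs \<le> length w" and k: "1 \<le> k"
  defines "t \<equiv> den w search s"
  shows "unchanged work s t"
    "t (S Empty) > 0 \<or> t (S Good) > 0 \<or> (t (S Near) > 0 \<and> t (S Unsat) > 0) \<longleftrightarrow>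
      iterative_k_backbone k (formula_of cs) x"
proof -
  let ?\<phi> = "formula_of cs"
  have E: "edge_at s (code a) (code b) \<longleftrightarrow> edge ?\<phi> a b" for a b
    using inv bad by (simp add: formula_inv_def)
  note walk = edge_at_relpowp[OF E] and reach = edge_at_reach[OF E]
  have co: "s (A Co (code b)) = code (compl b)" if e: "edge ?\<phi> a b" for a b
  proof -
    obtain C where "C \<in> set cs" "b \<in> set C"
      using e unfolding edge_def formula_of_def by blast
    then show ?thesis using inv by (auto simp: formula_inv_def)
  qed
  have target: "\<exists>a b. edge ?\<phi> a b \<and> s (A To e) = code b" if "e < s (S NE)" for e
  proof -
    obtain a b where "s (A From e) = code a" "s (A To e) = code b" by (metis code_surj)
    moreover from this have "edge ?\<phi> a b" using that E by (auto simp: edge_at_def)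
    ultimately show ?thesis by blast
  qed
  have ex: "(\<exists>e < s (S NE). q (s (A To e))) \<longleftrightarrow> (\<exists>a b. edge ?\<phi> a b \<and> q (code b))" for q
  proof
    assume "\<exists>a b. edge ?\<phi> a b \<and> q (code b)"
    then show "\<exists>e < s (S NE). q (s (A To e))"
      using E unfolding edge_at_def by metis
  qed (use target in metis)
  have short: "short_cycle s k (code b) \<longleftrightarrow> (\<exists>n\<le>k. (edge ?\<phi> ^^ n) (compl b) b)" if "edge ?\<phi> a b" for a b
    using walk co[OF that] by (simp add: short_cycle_def)
  have hit: "hits s x (code b) \<longleftrightarrow> (\<exists>l. var_of l = x \<and> (edge ?\<phi>)\<^sup>*\<^sup>* b l)" for b
    unfolding hits_def ex_lit_var using reach[of b "Neg x"] reach[of b "Pos x"] by (simp add: mult_2)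
  have cyc: "cyclic s (code b) \<longleftrightarrow> (edge ?\<phi>)\<^sup>*\<^sup>* (compl b) b \<and> (edge ?\<phi>)\<^sup>*\<^sup>* b (compl b)"
    if "edge ?\<phi> a b" for a b
    using reach co[OF that] by (simp add: cyclic_def)
  \<comment> \<open>\<open>compl b\<close> and \<open>b\<close> differ, so the walk has a last edge:
    a search over edge targets misses no candidate.\<close>
  have last: "\<exists>a. edge ?\<phi> a b" if "(edge ?\<phi> ^^ n) (compl b) b" for n b
    using that by (metis compl_neq(1) reach_last relpowp_imp_rtranclp)
  have 1: "s (S NE) \<le> length w" "\<And>i. s (A Dist i) = 0" "s (S Near) = 0" "s (S Good) = 0" "s (S Unsat) = 0"
    using inv len by (auto simp: formula_inv_def)
  \<comment> \<open>The contrapositive of an edge into \<open>b\<close> leaves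
    \<open>compl b\<close>, so the first search starts at an endpoint.\<close>
  have 2: "endpoint s (s (A Co (s (A To e))))" if e: "e < s (S NE)" for e
  proof -
    obtain a b where ab: "edge ?\<phi> a b" "s (A To e) = code b" using target[OF e] by blast
    then have "edge_at s (code (compl b)) (code (compl a))" using E edge_compl by blast
    then show ?thesis using ab(2) co[OF ab(1)] by (auto simp: endpoint_def)
  qed
  note sc = search_correct[OF 1 xk 2, folded t_def]
  show "unchanged work s t" by (rule sc(1))
  have empty: "t (S Empty) > 0 \<longleftrightarrow> {} \<in> ?\<phi>"
    using unchanged_work(1)[OF sc(1), of Empty] inv bad by (auto simp: formula_inv_def formula_of_def)
  have near: "t (S Near) > 0 \<longleftrightarrow> (\<exists>m. \<exists>n\<le>k. (edge ?\<phi> ^^ n) (compl m) m)"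
    using trans[OF sc(2) ex] short last by blast
  have good: "t (S Good) > 0 \<longleftrightarrow>
      (\<exists>m. (\<exists>n\<le>k. (edge ?\<phi> ^^ n) (compl m) m) \<and> (\<exists>l. var_of l = x \<and> (edge ?\<phi>)\<^sup>*\<^sup>* m l))"
    using trans[OF sc(3) ex[of "\<lambda>i. short_cycle s k i \<and> hits s x i"]] short last hit by blast
  have unsat: "t (S Unsat) > 0 \<longleftrightarrow> contradictory ?\<phi>"
  proof -
    have "\<exists>a. edge ?\<phi> a p" if "(edge ?\<phi>)\<^sup>*\<^sup>* (compl p) p" for p
      using that by (metis compl_neq(1) reach_last)
    then show ?thesis
      unfolding contradictory_def using trans[OF sc(4) ex] cyc by blast
  qed
  have krom: "?\<phi> \<in> krom" using inv bad by (simp add: formula_inv_def formula_of_krom_iff)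
  show "t (S Empty) > 0 \<or> t (S Good) > 0 \<or> (t (S Near) > 0 \<and> t (S Unsat) > 0) \<longleftrightarrow>
      iterative_k_backbone k ?\<phi> x"
    unfolding iterative_k_backbone_krom_iff[OF krom k] empty near good unsat by blast
qed

lemma decider_correct:
  "den w decider (\<lambda>_. 0) (S Ans) > 0 \<longleftrightarrow> w \<in> iterative_local_backbone krom"
proof (cases "\<exists>cs x k. parse w = Done cs x k")
  case False
  let ?s = "den w (For P parse_step) (\<lambda>_. 0)"
  have "parse_inv (parse w) ?s" by (rule parse_loop_inv)
  moreover have "target_inv t s \<Longrightarrow> s (S Ans) = 0" for t s
    by (cases t) (auto simp: formula_inv_def)
  ultimately have "?s (S Mode) \<noteq> 5" "?s (S Ans) = 0"
    using False by (cases "parse w"; auto simp: formula_inv_def)+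
  then have "den w decider (\<lambda>_. 0) (S Ans) = 0"
    by (simp add: decider_def del: den.simps(6))
  moreover have "w \<notin> iterative_local_backbone krom"
    using False parse_enc_instance unfolding iterative_local_backbone_def by blast
  ultimately show ?thesis by simp
next
  case True
  then obtain cs x k where parse: "parse w = Done cs x k" by blast
  let ?\<phi> = "formula_of cs"
  define s where "s = den w (For P parse_step) (\<lambda>_. 0)"
  have w: "w = enc_instance cs x k" using parse parse_eq_Done_iff by blast
  \<comment> \<open>An encoding determines its instance, so the existential quantifiers of the
    language disappear.\<close>
  have mem: "w \<in> iterative_local_backbone krom \<longleftrightarrow>
      ?\<phi> \<in> krom \<and> x \<in> vars ?\<phi> \<and> 1 \<le> k \<and> iterative_k_backbone k ?\<phi> x"
    using parse parse_eq_Done_iff unfolding iterative_local_backbone_def krom_def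
    by (smt (verit, del_insts) mem_Collect_eq parse_enc_instance pstate.inject(6))
  have s: "s (S Mode) = 5" "formula_inv cs [] s" "s (S XV) = x" "s (S KV) = k"
    using parse_loop_inv[of w] parse unfolding s_def by simp_all
  have ans: "s (S Ans) = 0" using s by (simp add: formula_inv_def)
  have bad: "s (S Bad) = 0 \<longleftrightarrow> ?\<phi> \<in> krom"
    using s by (simp add: formula_inv_def formula_of_krom_iff)
  have occ: "s (A Occ x) > 0 \<longleftrightarrow> x \<in> vars ?\<phi>"
    using s by (simp add: formula_inv_def vars_def formula_of_def)
  let ?t = "den w search s"
  have run: "den w decider (\<lambda>_. 0) (S Ans) =
      (if s (S Bad) = 0 \<and> k > 0 \<and> s (A Occ x) > 0
       then if ?t (S Near) > 0 \<and> ?t (S Unsat) > 0 then 1 else ?t (S Empty) + ?t (S Good) else 0)"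
    using s ans unfolding decider_def den.simps(4) s_def[symmetric] by simp
  show ?thesis
  proof (cases "s (S Bad) = 0 \<and> k > 0 \<and> s (A Occ x) > 0")
    case False
    then show ?thesis using run mem bad occ by auto
  next
    case True
    have "2 * length cs \<le> length w" using w length_enc_instance by simp
    with True s have "?t (S Empty) > 0 \<or> ?t (S Good) > 0 \<or> (?t (S Near) > 0 \<and> ?t (S Unsat) > 0) \<longleftrightarrow>
        iterative_k_backbone k ?\<phi> x"
      by (intro search_formula(2)) auto
    then show ?thesis using run mem bad occ True by auto
  qed
qed

theorem theorem7: "iterative_local_backbone krom \<in> polynomial_time"
  using den_polynomial_time[of decider] decider_correct by blast

end
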